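(* Let $d\ge1$, let $m=\lfloor d/2\rfloor$, and let $x_1,\dots,x_m$ be homogeneous generators of the $\mathbb{Q}$-algebra $\mathcal{A}(d)$ with $x_j$ of norm $j$. Then $x_1,\dots,x_m$ are algebraically independent in norms up to $d-m$ (i.e. $I_d$ has no non-zero element of norm $\le d-m$). If $d=2m\ge2$ is even, there is precisely one minimal relation among $x_1,\dots,x_m$ in norm $m+1$; if $d=2m+1\ge5$ is odd, there are precisely two minimal relations among $x_1,\dots,x_m$ in norm $m+2$. In other words, the module of indecomposable relations $I_d/\mathbb{Q}[X_1,\dots,X_m]_+\cdot I_d$ of $\mathcal{A}(d)$ is concentrated in norms at least $d-m+1$, and in norm $d-m+1$ it has dimension $1$ for $d\ge2$ even, and dimension $2$ for $d\ge5$ odd.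
   Context: $\mathcal{A}(d):=H^*(\mathrm{Hilb}^d(\mathbb{C}^2);\mathbb{Q})$ is the rational cohomology algebra of the Hilbert scheme of $d$ points of $\mathbb{C}^2$; it is a finite-dimensional graded commutative $\mathbb{Q}$-algebra concentrated in even degrees. The norm of a homogeneous element of even degree is half its degree. By a theorem of Lehn and Sorger, $\mathcal{A}(d)$ is identified, as a graded $\mathbb{Q}$-algebra, with the following combinatorial algebra. For $\sigma$ in the symmetric group $\mathfrak{S}_d$ let $N(\sigma)$ be the minimal number of transpositions whose product is $\sigma$ (equivalently, $d$ minus the number of cycles of $\sigma$, fixed points included). Let $\mathrm{grad}^N\mathbb{Q}[\mathfrak{S}_d]$ be the $\mathbb{Q}$-vector space with basis $\{[\sigma]:\sigma\in\mathfrak{S}_d\}$, with $[\sigma]$ of norm $N(\sigma)$ (degree $2N(\sigma)$), and with multiplication $[\sigma]\cdot[\tau]=[\sigma\tau]$ if $N(\sigma\tau)=N(\sigma)+N(\tau)$, and $[\sigma]\cdot[\tau]=0$ otherwise. Then $\mathcal{A}(d)\cong(\mathrm{grad}^N\mathbb{Q}[\mathfrak{S}_d])^{\mathfrak{S}_d}$, the subalgebra of invariants under the conjugation action of $\mathfrak{S}_d$. It is known that $\mathcal{A}(d)$ admits homogeneous generating sets $x_1,\dots,x_m$ with $x_j$ of norm $j$. Given such a set, $\mathbb{Q}[X_1,\dots,X_m]$ is the graded polynomial ring with $X_j$ of degree $2j$ (norm $j$), $\mathbb{Q}[X_1,\dots,X_m]_+$ is the ideal spanned by monomials of positive norm, $\phi\colon\mathbb{Q}[X_1,\dots,X_m]\to\mathcal{A}(d)$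 is the surjective graded algebra homomorphism $X_j\mapsto x_j$, and $I_d=\ker\phi$. A set of minimal relations is a set of homogeneous elements of $I_d$ projecting to a vector space basis of $I_d/\mathbb{Q}[X_1,\dots,X_m]_+\cdot I_d$; this graded vector space is called the module of indecomposable relations. The number of minimal relations in a given norm is the dimension of this quotient in that norm. *)

theory Defs
  imports Complex_Main "HOL-Algebra.Sym_Groups" "HOL-Algebra.Module" "HOL-Library.Poly_Mapping"
begin

definition transpositions :: "nat \<Rightarrow> (nat \<Rightarrow> nat) set" where
  "transpositions d = {transpose a b | a b. a \<in> {1..d} \<and> b \<in> {1..d} \<and> a \<noteq> b}"

definition perm_norm :: "nat \<Rightarrow> (nat \<Rightarrow> nat) \<Rightarrow> nat" where
  "perm_norm d \<sigma> = (LEAST n. \<exists>ts. length ts = n \<and> set ts \<subseteq> transpositions d \<and> foldr (\<circ>) ts id = \<sigma>)"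

text \<open>Elements of the group algebra are the coefficient functions that vanish off the symmetric
  group; \<^term>\<open>perm_basis \<sigma>\<close> is the basis vector \<open>[\<sigma>]\<close>.\<close>

type_synonym perm_vec = "(nat \<Rightarrow> nat) \<Rightarrow> rat"

definition perm_basis :: "(nat \<Rightarrow> nat) \<Rightarrow> perm_vec" where
  "perm_basis \<sigma> = (\<lambda>\<rho>. if \<rho> = \<sigma> then 1 else 0)"

definition basis_prod :: "nat \<Rightarrow> (nat \<Rightarrow> nat) \<Rightarrow> (nat \<Rightarrow> nat) \<Rightarrow> perm_vec" where
  "basis_prod d \<sigma> \<tau> =
     (if perm_norm d (\<sigma> \<circ> \<tau>) = perm_norm d \<sigma> + perm_norm d \<tau> then perm_basis (\<sigma> \<circ> \<tau>) else (\<lambda>_. 0))"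

definition graded_mult :: "nat \<Rightarrow> perm_vec \<Rightarrow> perm_vec \<Rightarrow> perm_vec" where
  "graded_mult d f g =
     (\<lambda>\<rho>. \<Sum>\<sigma>\<in>carrier (sym_group d). \<Sum>\<tau>\<in>carrier (sym_group d). f \<sigma> * g \<tau> * basis_prod d \<sigma> \<tau> \<rho>)"

definition graded_group_algebra :: "nat \<Rightarrow> (rat, perm_vec) module" where
  "graded_group_algebra d =
     \<lparr> carrier = {f. \<forall>\<sigma>. \<sigma> \<notin> carrier (sym_group d) \<longrightarrow> f \<sigma> = 0},
       mult = graded_mult d,
       one = perm_basis id,
       zero = (\<lambda>_. 0),
       add = (\<lambda>f g \<sigma>. f \<sigma> + g \<sigma>),
       smult = (\<lambda>c f \<sigma>. c * f \<sigma>) \<rparr>"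

definition conj_act :: "nat \<Rightarrow> (nat \<Rightarrow> nat) \<Rightarrow> perm_vec \<Rightarrow> perm_vec" where
  "conj_act d \<sigma> f = (\<lambda>\<rho>. \<Sum>\<tau>\<in>carrier (sym_group d). f \<tau> * perm_basis (\<sigma> \<circ> \<tau> \<circ> inv' \<sigma>) \<rho>)"

text \<open>The rational cohomology algebra of the Hilbert scheme of \<open>d\<close> points of the complex plane,
  in the Lehn--Sorger model: the conjugation invariants of the graded group algebra. The norm is
  half the cohomological degree.\<close>

definition hilb_coh :: "nat \<Rightarrow> (rat, perm_vec) module" where
  "hilb_coh d = (graded_group_algebra d)
     \<lparr> carrier := {f \<in> carrier (graded_group_algebra d).
                    \<forall>\<sigma>\<in>carrier (sym_group d). conj_act d \<sigma> f = f} \<rparr>"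

definition coh_homogeneous :: "nat \<Rightarrow> nat \<Rightarrow> perm_vec \<Rightarrow> bool" where
  "coh_homogeneous d n f \<longleftrightarrow>
     f \<in> carrier (hilb_coh d) \<and> (\<forall>\<sigma>. f \<sigma> \<noteq> 0 \<longrightarrow> perm_norm d \<sigma> = n)"

text \<open>Polynomials in the variables \<open>X\<^sub>j\<close>, \<open>j :: nat\<close>: a monomial is its exponent vector, and
  \<^term>\<open>poly_ring m\<close> is the subring of polynomials that involve only \<open>X\<^sub>1, \<dots>, X\<^sub>m\<close>.\<close>

type_synonym monomial = "nat \<Rightarrow>\<^sub>0 nat"
type_synonym rat_mpoly = "monomial \<Rightarrow>\<^sub>0 rat"

definition poly_ring :: "nat \<Rightarrow> rat_mpoly set" where
  "poly_ring m = {p. \<forall>a\<in>Poly_Mapping.keys p. Poly_Mapping.keys a \<subseteq> {1..m}}"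

definition mono_norm :: "monomial \<Rightarrow> nat" where
  "mono_norm a = (\<Sum>j\<in>Poly_Mapping.keys a. j * Poly_Mapping.lookup a j)"

definition homogeneous :: "nat \<Rightarrow> rat_mpoly \<Rightarrow> bool" where
  "homogeneous n p \<longleftrightarrow> (\<forall>a\<in>Poly_Mapping.keys p. mono_norm a = n)"

definition graded_part :: "nat \<Rightarrow> rat_mpoly set \<Rightarrow> rat_mpoly set" where
  "graded_part n V = {p \<in> V. homogeneous n p}"

definition augmentation_ideal :: "nat \<Rightarrow> rat_mpoly set" where
  "augmentation_ideal m = {p \<in> poly_ring m. \<forall>a\<in>Poly_Mapping.keys p. mono_norm a > 0}"

definition scalar_mult :: "rat \<Rightarrow> rat_mpoly \<Rightarrow> rat_mpoly" where
  "scalar_mult c p = Poly_Mapping.single 0 c * p"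

text \<open>The evaluation \<open>X\<^sub>j \<mapsto> x\<^sub>j\<close>. The products are well defined since \<^term>\<open>hilb_coh d\<close>, unlike
  \<^term>\<open>graded_group_algebra d\<close>, is commutative.\<close>

definition eval_hom :: "nat \<Rightarrow> nat \<Rightarrow> (nat \<Rightarrow> perm_vec) \<Rightarrow> rat_mpoly \<Rightarrow> perm_vec" where
  "eval_hom d m x p =
     (\<Oplus>\<^bsub>hilb_coh d\<^esub>a\<in>Poly_Mapping.keys p. Poly_Mapping.lookup p a \<odot>\<^bsub>hilb_coh d\<^esub>
        (\<Otimes>\<^bsub>hilb_coh d\<^esub>j\<in>{1..m}. x j [^]\<^bsub>hilb_coh d\<^esub> Poly_Mapping.lookup a j))"

text \<open>Generation as a rational algebra: every element is a polynomial in the \<open>x\<^sub>j\<close>.\<close>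

definition homogeneous_generators :: "nat \<Rightarrow> nat \<Rightarrow> (nat \<Rightarrow> perm_vec) \<Rightarrow> bool" where
  "homogeneous_generators d m x \<longleftrightarrow>
     (\<forall>j\<in>{1..m}. coh_homogeneous d j (x j)) \<and>
     eval_hom d m x ` poly_ring m = carrier (hilb_coh d)"

definition relation_ideal :: "nat \<Rightarrow> nat \<Rightarrow> (nat \<Rightarrow> perm_vec) \<Rightarrow> rat_mpoly set" where
  "relation_ideal d m x = {p \<in> poly_ring m. eval_hom d m x p = \<zero>\<^bsub>hilb_coh d\<^esub>}"

definition prod_ideal :: "rat_mpoly set \<Rightarrow> rat_mpoly set \<Rightarrow> rat_mpoly set" where
  "prod_ideal I J = {\<Sum>i<k. f i * g i | (k :: nat) f g. \<forall>i<k. f i \<in> I \<and> g i \<in> J}"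

definition decomposable_relations :: "nat \<Rightarrow> nat \<Rightarrow> (nat \<Rightarrow> perm_vec) \<Rightarrow> rat_mpoly set" where
  "decomposable_relations d m x = prod_ideal (augmentation_ideal m) (relation_ideal d m x)"

text \<open>For subspaces \<open>W \<subseteq> V\<close>, the classes modulo \<open>W\<close> of the elements of \<open>B \<subseteq> V\<close> are pairwise
  distinct and form a vector space basis of \<open>V / W\<close>: they span it, and no non-trivial linear
  combination of them vanishes in it.\<close>

definition projects_to_basis :: "rat_mpoly set \<Rightarrow> rat_mpoly set \<Rightarrow> rat_mpoly set \<Rightarrow> bool" where
  "projects_to_basis B V W \<longleftrightarrow>
     B \<subseteq> V \<and>
     (\<forall>v\<in>V. \<exists>F c. finite F \<and> F \<subseteq> B \<and> v - (\<Sum>b\<in>F. scalar_mult (c b) b) \<in> W) \<and>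
     (\<forall>F c. finite F \<and> F \<subseteq> B \<and> (\<Sum>b\<in>F. scalar_mult (c b) b) \<in> W \<longrightarrow> (\<forall>b\<in>F. c b = 0))"

definition has_quotient_dim :: "rat_mpoly set \<Rightarrow> rat_mpoly set \<Rightarrow> nat \<Rightarrow> bool" where
  "has_quotient_dim V W k \<longleftrightarrow> (\<exists>B. finite B \<and> card B = k \<and> projects_to_basis B V W)"

definition minimal_relations :: "nat \<Rightarrow> nat \<Rightarrow> (nat \<Rightarrow> perm_vec) \<Rightarrow> rat_mpoly set \<Rightarrow> bool" where
  "minimal_relations d m x R \<longleftrightarrow>
     (\<forall>r\<in>R. \<exists>n. homogeneous n r) \<and>
     projects_to_basis R (relation_ideal d m x) (decomposable_relations d m x)"

definition indecomposables_dim :: "nat \<Rightarrow> nat \<Rightarrow> (nat \<Rightarrow> perm_vec) \<Rightarrow> nat \<Rightarrow> nat \<Rightarrow> bool" where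
  "indecomposables_dim d m x n k \<longleftrightarrow>
     has_quotient_dim (graded_part n (relation_ideal d m x))
                      (graded_part n (decomposable_relations d m x)) k"

end

theory Submission
  imports Defs "HOL-Library.Multiset" "HOL-Library.Function_Algebras" "HOL-Combinatorics.Orbits"
begin

text \<open>The proof is a dimension count. Let \<open>p(n, k)\<close> be the number of partitions of \<open>n\<close> into at most
  \<open>k\<close> parts, which is also the number of partitions of \<open>n\<close> into parts of size at most \<open>k\<close>.

  The monomials of norm \<open>n\<close> in \<open>X\<^sub>1, \<dots>, X\<^sub>m\<close> are the partitions of \<open>n\<close> into parts of size at most
  \<open>m\<close>, so the polynomial ring has dimension \<open>p(n, m)\<close> in norm \<open>n\<close>. The invariants of the graded group
  algebra are the class functions, and the conjugacy classes of norm \<open>n\<close> are the cycle types with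
  \<open>d - n\<close> cycles; subtracting one from every cycle length turns them into the partitions of \<open>n\<close> into
  at most \<open>d - n\<close> parts. So the cohomology has dimension \<open>p(n, d - n)\<close> in norm \<open>n\<close>
  (lemma \<open>dim_coh_homogeneous\<close>). Evaluation at the generators is surjective in each norm, and
  therefore the relations of norm \<open>n\<close> form a space of dimension \<open>p(n, m) - p(n, d - n)\<close>
  (lemma \<open>dim_relations\<close>).

  For \<open>n \<le> d - m\<close> the bound \<open>d - n\<close> is at least \<open>m\<close>, so this difference cannot be positive,
  and there are no relations. For \<open>n = d - m + 1\<close> it is \<open>p(n, m) - p(n, m - 1)\<close>, the number of
  partitions of \<open>n\<close> into exactly \<open>m\<close> parts, which is \<open>p(n - m, m)\<close>: this is \<open>p(1, m) = 1\<close> if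
  \<open>d = 2m\<close> and \<open>m \<ge> 1\<close>, and \<open>p(2, m) = 2\<close> if \<open>d = 2m + 1\<close> and \<open>m \<ge> 2\<close>. A decomposable relation is a sum of
  products of a polynomial of positive norm with a relation, so it starts strictly above the lowest
  norm in which relations exist; hence in norm \<open>d - m + 1\<close> every relation is indecomposable
  (lemmas \<open>indecomposables_dim_eq\<close> and \<open>card_minimal_relations\<close>).

  The count relies on two facts about permutations: the norm of a permutation of \<open>{1..d}\<close> is \<open>d\<close> minus the
  number of its cycles (lemma \<open>perm_norm_eq\<close>), and cycle types classify conjugacy classes, with every
  partition of \<open>d\<close> occurring. On the algebraic side, evaluation of a monomial is an
  unordered product, so it only makes sense once class functions are known to form a commutative
  monoid under the graded product (lemma \<open>comm_monoid_hilb_coh\<close>).\<close>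

section \<open>Partition numbers\<close>

text \<open>The number of partitions of \<open>n\<close> into at most \<open>k\<close> parts: such a partition either has fewer parts
  than the bound, or loses one from each part.\<close>

fun partition_count :: "nat \<Rightarrow> nat \<Rightarrow> nat" where
  "partition_count n 0 = (if n = 0 then 1 else 0)"
| "partition_count n (Suc k) =
     partition_count n k + (if Suc k \<le> n then partition_count (n - Suc k) (Suc k) else 0)"

text \<open>The right-hand side of the recursion is an instance of its left-hand side, so as a rewrite rule it
  can be unfolded without end.\<close>

declare partition_count.simps(2) [simp del]

text \<open>Multisets of exactly \<open>k\<close> parts, where parts may be \<open>0\<close>, encode the partitions into at most \<open>k\<close>
  parts; padding with zeros fixes the size, which is what cycle types need.\<close>

definition weak_partitions :: "nat \<Rightarrow> nat \<Rightarrow> nat multiset set" where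
  "weak_partitions n k = {M. size M = k \<and> sum_mset M = n}"

definition monomials :: "nat \<Rightarrow> nat \<Rightarrow> monomial set" where
  "monomials n k = {a. Poly_Mapping.keys a \<subseteq> {1..k} \<and> mono_norm a = n}"

lemma sum_mset_image_Suc: "sum_mset (image_mset Suc M) = sum_mset M + size M"
  by (induction M) auto

lemma image_mset_Suc_pred:
  assumes "0 \<notin># M"
  shows "M = image_mset Suc (image_mset (\<lambda>i. i - 1) M)"
proof -
  have "image_mset Suc (image_mset (\<lambda>i. i - 1) M) = image_mset id M"
    unfolding multiset.map_comp
    using assms by (intro image_mset_cong) (metis Suc_pred' bot_nat_0.not_eq_extremum comp_apply id_apply)
  then show ?thesis by simp
qed

text \<open>Either some part is \<open>0\<close> and can be dropped, or every part can be lowered by one.\<close>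

lemma weak_partitions_Suc:
  "weak_partitions n (Suc k) = add_mset 0 ` weak_partitions n k \<union>
     (if Suc k \<le> n then image_mset Suc ` weak_partitions (n - Suc k) (Suc k) else {})"
    (is "?L = ?R")
proof (intro equalityI subsetI)
  fix M assume M: "M \<in> ?L"
  show "M \<in> ?R"
  proof (cases "0 \<in># M")
    case True
    then obtain M' where "M = add_mset 0 M'" by (meson multi_member_split)
    then show ?thesis using M by (auto simp: weak_partitions_def)
  next
    case False
    then obtain M' where M': "M = image_mset Suc M'" using image_mset_Suc_pred by blast
    then have "size M' = Suc k" using M by (simp add: weak_partitions_def)
    moreover from this have "n = sum_mset M' + Suc k"
      using M sum_mset_image_Suc[of M'] by (simp add: weak_partitions_def M')
    ultimately show ?thesis using M' by (auto simp: weak_partitions_def)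
  qed
next
  fix M assume "M \<in> ?R"
  then show "M \<in> ?L"
    by (auto simp: weak_partitions_def sum_mset_image_Suc split: if_splits)
qed

lemma weak_partitions_count:
  "finite (weak_partitions n k) \<and> card (weak_partitions n k) = partition_count n k"
proof (induction n k rule: partition_count.induct)
  case (1 n)
  have "weak_partitions n 0 = (if n = 0 then {{#}} else {})"
    by (auto simp: weak_partitions_def)
  then show ?case by simp
next
  case (2 n k)
  have inj0: "inj_on (add_mset (0::nat)) X" for X by (simp add: inj_on_def)
  have inj1: "inj_on (image_mset Suc) X" for X
    by (metis inj_Suc inj_on_subset multiset.inj_map subset_UNIV)
  have disj: "add_mset 0 ` X \<inter> image_mset Suc ` Y = {}" for X Y
    by (auto simp: add_mset_eq_single) (metis Zero_not_Suc image_iff set_image_mset union_single_eq_member)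
  define V where "V = weak_partitions (n - Suc k) (Suc k)"
  have "weak_partitions n (Suc k) = add_mset 0 ` weak_partitions n k \<union>
     (if Suc k \<le> n then image_mset Suc ` V else {})"
    unfolding V_def by (rule weak_partitions_Suc)
  then show ?case
    using 2 by (simp add: V_def[symmetric] card_Un_disjoint disj card_image partition_count.simps(2) [of n k] inj0 inj1)
qed

lemma mono_norm_superset:
  assumes "Poly_Mapping.keys a \<subseteq> K" "finite K"
  shows "mono_norm a = (\<Sum>j\<in>K. j * Poly_Mapping.lookup a j)"
  unfolding mono_norm_def
  by (rule sum.mono_neutral_left) (use assms in \<open>auto simp: in_keys_iff\<close>)

lemma mono_norm_plus: "mono_norm (a + b) = mono_norm a + mono_norm b"
proof -
  let ?K = "Poly_Mapping.keys a \<union> Poly_Mapping.keys b"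
  have "mono_norm (a + b) = (\<Sum>j\<in>?K. j * Poly_Mapping.lookup (a + b) j)"
    by (rule mono_norm_superset) (auto dest: set_mp[OF Poly_Mapping.keys_add])
  then show ?thesis
    by (simp add: mono_norm_superset[of a ?K] mono_norm_superset[of b ?K] lookup_add
        algebra_simps sum.distrib)
qed

lemma mono_norm_single [simp]: "mono_norm (Poly_Mapping.single j c) = j * c"
  by (simp add: mono_norm_def)

text \<open>The same recursion for exponent vectors: the last variable either does not occur, or can be divided
  out once. That both families obey it replaces the conjugation of Young diagrams.\<close>

lemma monomials_Suc:
  "monomials n (Suc k) = monomials n k \<union>
     (if Suc k \<le> n then (\<lambda>a. a + Poly_Mapping.single (Suc k) 1) ` monomials (n - Suc k) (Suc k) else {})"
    (is "?L = ?R")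
proof (intro equalityI subsetI)
  fix a assume a: "a \<in> ?L"
  show "a \<in> ?R"
  proof (cases "Suc k \<in> Poly_Mapping.keys a")
    case True
    define b where "b = a - Poly_Mapping.single (Suc k) 1"
    have ab: "a = b + Poly_Mapping.single (Suc k) 1"
      using True by (intro poly_mapping_eqI)
        (auto simp: b_def lookup_add lookup_minus lookup_single in_keys_iff when_def)
    have "Poly_Mapping.keys b \<subseteq> Poly_Mapping.keys a"
      by (auto simp: b_def in_keys_iff lookup_minus)
    then show ?thesis
      using a ab by (auto simp: monomials_def mono_norm_plus)
  next
    case False
    have "x \<le> k" if "x \<in> Poly_Mapping.keys a" for x
      using that False a by (cases "x = Suc k") (auto simp: monomials_def dest!: subsetD)
    then show ?thesis using a by (auto simp: monomials_def)
  qed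
next
  fix a assume "a \<in> ?R"
  then show "a \<in> ?L"
    by (force simp: monomials_def mono_norm_plus split: if_splits dest: set_mp[OF Poly_Mapping.keys_add])
qed

lemma monomials_count:
  "finite (monomials n k) \<and> card (monomials n k) = partition_count n k"
proof (induction n k rule: partition_count.induct)
  case (1 n)
  have "monomials n 0 = (if n = 0 then {0} else {})"
    by (auto simp: monomials_def mono_norm_def)
  then show ?case by simp
next
  case (2 n k)
  let ?s = "\<lambda>a. a + Poly_Mapping.single (Suc k) (1::nat)"
  have inj: "inj_on ?s X" for X by (simp add: inj_on_def)
  have disj: "monomials n k \<inter> ?s ` Y = {}" for Y
    by (auto simp: monomials_def subset_iff in_keys_iff lookup_add)
      (metis Suc_n_not_le_n add_is_0 lookup_single_eq one_neq_zero zero_less_Suc)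
  define V where "V = monomials (n - Suc k) (Suc k)"
  have "monomials n (Suc k) = monomials n k \<union> (if Suc k \<le> n then ?s ` V else {})"
    unfolding V_def by (rule monomials_Suc)
  then show ?case
    using 2 by (simp add: V_def[symmetric] card_Un_disjoint disj card_image partition_count.simps(2) [of n k] inj del: One_nat_def)
qed

lemma partition_count_mono: "k \<le> l \<Longrightarrow> partition_count n k \<le> partition_count n l"
  by (induction l rule: dec_induct) (auto simp: partition_count.simps(2) [of n] intro: trans_le_add1)

lemma partition_count_0 [simp]: "partition_count 0 k = 1"
  by (induction k) (simp_all add: partition_count.simps(2))

lemma partition_count_1: "k \<ge> 1 \<Longrightarrow> partition_count 1 k = 1"
  by (induction k rule: dec_induct) (simp_all add: partition_count.simps(2))

lemma partition_count_2: "k \<ge> 2 \<Longrightarrow> partition_count 2 k = 2"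
proof (induction k rule: dec_induct)
  case base
  show ?case by (simp add: numeral_2_eq_2 partition_count.simps(2))
qed (simp add: partition_count.simps(2))

section \<open>Cycle types\<close>

text \<open>Fixed points are orbits of size one and are recorded too.\<close>

definition cycle_type :: "('a \<Rightarrow> 'a) \<Rightarrow> 'a set \<Rightarrow> nat multiset" where
  "cycle_type f A = image_mset card (mset_set (orbit f ` A))"

lemma permutes_orbit:
  assumes "f permutes A" "finite A"
  shows self_in_orbit: "x \<in> orbit f x"
    and orbit_powers: "orbit f x = range (\<lambda>n. (f ^^ n) x)"
    and finite_permutes_orbit: "finite (orbit f x)"
proof -
  have p: "permutation f" using assms permutation_permutes by blast
  show x: "x \<in> orbit f x" using permutation_self_in_orbit[OF p] .
  show "orbit f x = range (\<lambda>n. (f ^^ n) x)"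
    using orbit_altdef_self_in[OF x] by auto
  show "finite (orbit f x)" using finite_orbit[OF x] .
qed

lemma orbit_eq_of_mem:
  assumes "f permutes A" "finite A" "y \<in> orbit f x"
  shows "orbit f y = orbit f x"
  using assms by (meson cyclic_on_orbit orbit_cyclic_eq3 permutation_permutes)

lemma size_cycle_type: "size (cycle_type f A) = card (orbit f ` A)"
  by (simp add: cycle_type_def)

lemma cycle_type_pos:
  assumes "f permutes A" "finite A"
  shows "0 \<notin># cycle_type f A"
  using assms finite_permutes_orbit[OF assms]
  by (auto simp: cycle_type_def card_eq_0_iff orbit_nonempty)

lemma sum_cycle_type:
  assumes "f permutes A" "finite A"
  shows "sum_mset (cycle_type f A) = card A"
proof -
  have "sum_mset (cycle_type f A) = (\<Sum>Z\<in>orbit f ` A. card Z)"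
    by (simp add: cycle_type_def sum_unfold_sum_mset)
  also have "\<dots> = card (\<Union> (orbit f ` A))"
  proof (rule card_Union_disjoint[symmetric])
    show "pairwise disjnt (orbit f ` A)"
      by (auto simp: pairwise_def disjnt_def) (metis assms orbit_eq_of_mem)+
    show "\<And>Z. Z \<in> orbit f ` A \<Longrightarrow> finite Z"
      using finite_permutes_orbit[OF assms] by auto
  qed
  also have "\<Union> (orbit f ` A) = A"
    using self_in_orbit[OF assms] permutes_orbit_subset[OF assms(1)] by blast
  finally show ?thesis .
qed

text \<open>An equivariant bijection carries orbits onto orbits. Conjugation by a permutation is such a bijection.\<close>

lemma cycle_type_equivariant:
  assumes "f permutes A" "g permutes B" "finite A" "bij_betw h A B"
    and "\<And>x. x \<in> A \<Longrightarrow> h (f x) = g (h x)"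
  shows "cycle_type g B = cycle_type f A"
proof -
  have finB: "finite B" using assms bij_betw_finite by blast
  have pow: "(g ^^ n) (h x) = h ((f ^^ n) x) \<and> (f ^^ n) x \<in> A" if "x \<in> A" for x n
    using that assms(5) by (induction n) (auto simp: permutes_in_image[OF assms(1)])
  have orb: "orbit g (h x) = h ` orbit f x" if "x \<in> A" for x
    using pow[OF that]
    by (auto simp: orbit_powers[OF assms(1,3)] orbit_powers[OF assms(2) finB])
  have sub: "Z \<subseteq> A" if "Z \<in> orbit f ` A" for Z
    using that permutes_orbit_subset[OF assms(1)] by auto
  have "orbit g ` B = (`) h ` orbit f ` A"
    using orb bij_betw_imp_surj_on[OF assms(4)] by (auto simp: image_image)
  moreover have "inj_on ((`) h) (orbit f ` A)"
    by (rule inj_on_subset[OF inj_on_image_Pow]) (use assms(4) sub in \<open>auto simp: bij_betw_def\<close>)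
  moreover have "card (h ` Z) = card Z" if "Z \<in> orbit f ` A" for Z
    using assms(4) sub[OF that] by (meson bij_betw_def card_image inj_on_subset)
  ultimately show ?thesis
    using assms(3) image_mset_mset_set[of "(`) h" "orbit f ` A"]
    by (auto simp: cycle_type_def multiset.map_comp simp flip: image_mset_mset_set
        intro!: image_mset_cong)
qed

lemma funpow_eq_iff_mod_card_orbit:
  assumes "f permutes A" "finite A"
  shows "(f ^^ i) x = (f ^^ j) x \<longleftrightarrow> i mod card (orbit f x) = j mod card (orbit f x)"
proof -
  define c where "c = funpow_dist1 f x x"
  have x: "x \<in> orbit f x" by (rule self_in_orbit[OF assms])
  have per: "(f ^^ c) x = x" and c0: "c > 0"
    using funpow_dist1_prop[OF x] by (auto simp: c_def)
  have inj: "inj_on (\<lambda>n. (f ^^ n) x) {0..<c}"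
    unfolding c_def by (rule inj_on_funpow_dist1[OF x])
  have "orbit f x = (\<lambda>n. (f ^^ n) x) ` {0..<c}"
    unfolding c_def by (rule orbit_conv_funpow_dist1[OF x])
  then have card: "card (orbit f x) = c" using card_image[OF inj] by simp
  have "(f ^^ i) x = (f ^^ (i mod c)) x" for i
    using funpow_mod_eq[OF per] by simp
  then have "(f ^^ i) x = (f ^^ j) x \<longleftrightarrow> (f ^^ (i mod c)) x = (f ^^ (j mod c)) x" by metis
  also have "\<dots> \<longleftrightarrow> i mod c = j mod c"
    using inj_onD[OF inj, of "i mod c" "j mod c"] c0 by auto
  finally show ?thesis by (simp add: card)
qed

text \<open>Match the orbits of \<open>f\<close> with orbits of \<open>g\<close> of the same size, choose a base point in every orbit,
  and send the \<open>i\<close>-th iterate of a base point to the \<open>i\<close>-th iterate of the matching base point. This is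
  well defined and injective because iterates on both sides coincide under the same congruence.\<close>

lemma conjugate_if_same_cycle_type:
  assumes f: "f permutes A" and g: "g permutes A" and fin: "finite A"
    and eq: "cycle_type f A = cycle_type g A"
  shows "\<exists>h. h permutes A \<and> h \<circ> f = g \<circ> h"
proof -
  \<comment> \<open>A bijection between the two sets of orbits exists by counting, and a permutation \<open>q\<close> of
  the first set corrects it so that sizes agree.\<close>
  define X Y where "X = orbit f ` A" and "Y = orbit g ` A"
  have finX: "finite X" "finite Y" using fin by (auto simp: X_def Y_def)
  have "card X = card Y"
    using arg_cong[OF eq, of size] by (simp add: size_cycle_type X_def Y_def)
  then obtain e where e: "bij_betw e X Y"
    using finX by (meson finite_same_card_bij)
  then have "image_mset card (mset_set X) = image_mset (card \<circ> e) (mset_set X)"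
    using eq image_mset_mset_set[of e X]
    by (simp add: cycle_type_def X_def[symmetric] Y_def[symmetric] bij_betw_def
        flip: multiset.map_comp)
  then obtain q where q: "q permutes X" "\<forall>Z\<in>X. card Z = (card \<circ> e) (q Z)"
    by (rule image_mset_eq_implies_permutes[OF finX(1)])
  define \<beta> where "\<beta> = e \<circ> q"
  have \<beta>: "bij_betw \<beta> X Y" unfolding \<beta>_def using e q(1) bij_betw_trans permutes_imp_bij by blast
  have card\<beta>: "card (\<beta> Z) = card Z" if "Z \<in> X" for Z using q(2) that by (simp add: \<beta>_def)
  have "\<exists>x\<in>A. orbit f x = Z" if "Z \<in> X" for Z using that by (auto simp: X_def)
  then obtain r where r: "r Z \<in> A" "orbit f (r Z) = Z" if "Z \<in> X" for Z by metis
  have "\<exists>y\<in>A. orbit g y = \<beta> Z" if "Z \<in> X" for Z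
    using that bij_betwE[OF \<beta>] by (fastforce simp: Y_def)
  then obtain s where s: "s Z \<in> A" "orbit g (s Z) = \<beta> Z" if "Z \<in> X" for Z by metis
  have "\<exists>n. (f ^^ n) (r (orbit f x)) = x" if "x \<in> A" for x
  proof -
    have "x \<in> orbit f (r (orbit f x))"
      using r(2)[of "orbit f x"] self_in_orbit[OF f fin, of x] that by (simp add: X_def)
    then show ?thesis unfolding orbit_powers[OF f fin, of "r _"] by (metis rangeE)
  qed
  then obtain ix where ix: "(f ^^ ix x) (r (orbit f x)) = x" if "x \<in> A" for x by metis
  \<comment> \<open>\<open>ix x\<close> is some index at which \<open>x\<close> is reached from the base point of its orbit.\<close>
  define h where "h x = (if x \<in> A then (g ^^ ix x) (s (orbit f x)) else x)" for x
  have h_pow: "h ((f ^^ i) (r Z)) = (g ^^ i) (s Z)" if "Z \<in> X" for Z i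
  proof -
    let ?x = "(f ^^ i) (r Z)"
    have xA: "?x \<in> A" using r(1)[OF that] permutes_in_image[OF permutes_funpow[OF f]] by blast
    have ox: "orbit f ?x = Z"
    proof -
      have "?x \<in> orbit f (r Z)" using orbit_powers[OF f fin] by auto
      then show ?thesis using orbit_eq_of_mem[OF f fin] r(2)[OF that] by metis
    qed
    have "(f ^^ ix ?x) (r Z) = (f ^^ i) (r Z)" using ix[OF xA] ox by simp
    then have "(g ^^ ix ?x) (s Z) = (g ^^ i) (s Z)"
      by (simp add: funpow_eq_iff_mod_card_orbit[OF f fin] funpow_eq_iff_mod_card_orbit[OF g fin]
          r(2)[OF that] s(2)[OF that] card\<beta>[OF that])
    then show ?thesis using xA ox by (simp add: h_def)
  qed
  have hA: "h x \<in> A" if "x \<in> A" for x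
    using that s(1)[of "orbit f x"] permutes_in_image[OF permutes_funpow[OF g]]
    by (simp add: h_def X_def)
  have orb_h: "orbit g (h x) = \<beta> (orbit f x)" if "x \<in> A" for x
  proof -
    have "h x \<in> orbit g (s (orbit f x))"
      using that orbit_powers[OF g fin] by (auto simp: h_def)
    then show ?thesis using orbit_eq_of_mem[OF g fin] s(2)[of "orbit f x"] that
      by (metis X_def imageI)
  qed
  have "inj_on h A"
  proof (rule inj_onI)
    fix x y assume xy: "x \<in> A" "y \<in> A" "h x = h y"
    then have Z: "orbit f x = orbit f y"
      using orb_h bij_betw_imp_inj_on[OF \<beta>] by (metis X_def imageI inj_onD)
    have OX: "orbit f y \<in> X" using xy by (simp add: X_def)
    have "(g ^^ ix x) (s (orbit f y)) = (g ^^ ix y) (s (orbit f y))"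
      using xy Z by (simp add: h_def)
    then have "(f ^^ ix x) (r (orbit f y)) = (f ^^ ix y) (r (orbit f y))"
      by (simp add: funpow_eq_iff_mod_card_orbit[OF f fin] funpow_eq_iff_mod_card_orbit[OF g fin]
          r(2)[OF OX] s(2)[OF OX] card\<beta>[OF OX])
    then show "x = y" using ix[OF xy(1)] ix[OF xy(2)] Z by metis
  qed
  moreover have "h ` A \<subseteq> A" using hA by auto
  ultimately have "bij_betw h A A"
    by (simp add: bij_betw_def endo_inj_surj fin)
  then have "h permutes A"
    by (rule bij_imp_permutes) (simp add: h_def)
  moreover have "h (f x) = g (h x)" for x
  proof (cases "x \<in> A")
    case True
    then have OX: "orbit f x \<in> X" by (simp add: X_def)
    have "h (f x) = h ((f ^^ Suc (ix x)) (r (orbit f x)))" by (simp add: ix[OF True])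
    also have "\<dots> = g (h ((f ^^ ix x) (r (orbit f x))))"
      unfolding h_pow[OF OX] by simp
    finally show ?thesis unfolding ix[OF True] .
  next
    case False
    then show ?thesis using f g by (simp add: h_def permutes_not_in)
  qed
  ultimately show ?thesis by (auto simp: fun_eq_iff)
qed

text \<open>Transport the rotation of \<open>{0..<k}\<close> along an enumeration of the set.\<close>

lemma exists_cyclic_permutation:
  assumes "finite K" "K \<noteq> {}"
  shows "\<exists>c. c permutes K \<and> (\<forall>x\<in>K. orbit c x = K)"
proof -
  define k where "k = card K"
  have k: "k > 0" using assms by (simp add: k_def card_gt_0_iff)
  obtain b where b: "bij_betw b {0..<k} K"
    using ex_bij_betw_nat_finite[OF assms(1)] by (auto simp: k_def)
  define b' where "b' = inv_into {0..<k} b"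
  have b'b: "b' (b i) = i" if "i < k" for i
    using b that by (simp add: b'_def bij_betw_def)
  have bb': "b (b' x) = x" "b' x < k" if "x \<in> K" for x
    using b that bij_betw_inv_into_right[OF b that] bij_betwE[OF bij_betw_inv_into[OF b]]
    by (auto simp: b'_def)
  have bK: "b i \<in> K" if "i < k" for i using bij_betwE[OF b] that by auto
  define c where "c x = (if x \<in> K then b (Suc (b' x) mod k) else x)" for x
  have c_b: "c (b (n mod k)) = b (Suc n mod k)" for n
    using k by (simp add: c_def bK b'b mod_Suc_eq)
  have pow: "(c ^^ n) (b (i mod k)) = b ((i + n) mod k)" for n i
    by (induction n) (simp_all add: c_b)
  have "c ` K \<subseteq> K" using k by (auto simp: c_def bK)
  moreover have "K \<subseteq> c ` K"
  proof
    fix x assume x: "x \<in> K"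
    have "c (b ((b' x + (k - 1)) mod k)) = b ((b' x + k) mod k)"
      using k by (subst c_b) simp
    also have "\<dots> = x" using bb'[OF x] by simp
    finally show "x \<in> c ` K" using k bK by (metis imageI mod_less_divisor)
  qed
  ultimately have "c ` K = K" by blast
  then have "bij_betw c K K"
    using assms(1) by (simp add: bij_betw_def eq_card_imp_inj_on)
  then have perm: "c permutes K" by (rule bij_imp_permutes) (simp add: c_def)
  have "orbit c x = K" if x: "x \<in> K" for x
  proof
    show "orbit c x \<subseteq> K" using permutes_orbit_subset[OF perm x] .
    show "K \<subseteq> orbit c x"
    proof
      fix y assume y: "y \<in> K"
      have "(c ^^ (k - b' x + b' y)) x = b ((b' x + (k - b' x + b' y)) mod k)"
        using pow[of "k - b' x + b' y" "b' x"] bb'[OF x] by simp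
      also have "b' x + (k - b' x + b' y) = b' y + k" using bb'(2)[OF x] by simp
      finally have "(c ^^ (k - b' x + b' y)) x = y" using bb'[OF y] by simp
      then show "y \<in> orbit c x" using orbit_powers[OF perm assms(1)] by (metis rangeI)
    qed
  qed
  with perm show ?thesis by blast
qed

text \<open>Split off a subset for one part of the multiset, rotate it, and recurse on the complement.\<close>

lemma exists_permutation_of_cycle_type:
  assumes "finite A" "0 \<notin># M" "sum_mset M = card A"
  shows "\<exists>f. f permutes A \<and> cycle_type f A = M"
  using assms
proof (induction M arbitrary: A)
  case empty
  then show ?case by (intro exI[of _ id]) (auto simp: cycle_type_def permutes_id)
next
  case (add k M)
  have k: "k > 0" "k \<le> card A" using add.prems by auto
  obtain K where K: "K \<subseteq> A" "card K = k"
    using obtain_subset_with_card_n[OF k(2)] by metis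
  have finK: "finite K" using K add.prems finite_subset by blast
  have "K \<noteq> {}" using K k by auto
  then obtain c where c: "c permutes K" "\<forall>x\<in>K. orbit c x = K"
    using exists_cyclic_permutation[OF finK] by blast
  define B where "B = A - K"
  have "card B = sum_mset M"
    using add.prems K finK by (simp add: B_def card_Diff_subset)
  then obtain g where g: "g permutes B" "cycle_type g B = M"
    using add.IH[of B] add.prems by (auto simp: B_def)
  have finB: "finite B" using add.prems by (simp add: B_def)
  have KB: "K \<inter> B = {}" "A = K \<union> B" using K by (auto simp: B_def)
  define f where "f = g \<circ> c"
  have f: "f permutes A"
    unfolding f_def using c(1) g(1) KB by (intro permutes_compose) (auto intro: permutes_subset)
  have powK: "(f ^^ n) x = (c ^^ n) x \<and> (c ^^ n) x \<in> K" if "x \<in> K" for x n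
    using that
  proof (induction n)
    case (Suc n)
    then have "c ((c ^^ n) x) \<in> K" using permutes_in_image[OF c(1)] by simp
    moreover from this have "g (c ((c ^^ n) x)) = c ((c ^^ n) x)"
      using KB g(1) by (meson disjoint_iff permutes_not_in)
    ultimately show ?case using Suc by (simp add: f_def)
  qed auto
  have powB: "(f ^^ n) x = (g ^^ n) x \<and> (g ^^ n) x \<in> B" if "x \<in> B" for x n
    using that
  proof (induction n)
    case (Suc n)
    then have "c ((g ^^ n) x) = (g ^^ n) x" using KB c(1) by (meson disjoint_iff permutes_not_in)
    then show ?case using Suc permutes_in_image[OF g(1)] by (simp add: f_def)
  qed auto
  have orbK: "orbit f x = K" if "x \<in> K" for x
    using that c(2) powK[OF that] by (simp add: orbit_powers[OF f add.prems(1)] orbit_powers[OF c(1) finK])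
  have orbB: "orbit f x = orbit g x" if "x \<in> B" for x
    using powB[OF that] by (simp add: orbit_powers[OF f add.prems(1)] orbit_powers[OF g(1) finB])
  have "orbit f ` K = {K}" using orbK \<open>K \<noteq> {}\<close> by auto
  moreover have "orbit f ` B = orbit g ` B" using orbB by (rule image_cong[OF refl])
  ultimately have "orbit f ` A = insert K (orbit g ` B)" using KB by (simp add: image_Un)
  moreover have "K \<notin> orbit g ` B"
    using KB \<open>K \<noteq> {}\<close> permutes_orbit_subset[OF g(1)] by fastforce
  ultimately have "cycle_type f A = add_mset k M"
    using K g(2) finB by (simp add: cycle_type_def)
  with f show ?case by blast
qed

section \<open>The norm of a permutation\<close>

text \<open>Lower bound for the length of a word in transpositions. Functions invariant under the product of a
  word are easy to construct: start with the identity, which has \<open>d\<close> values, and for each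
  transposition merge the values at its two points. Each letter costs at most one value.\<close>

lemma invariant_function_of_word:
  assumes "set ts \<subseteq> transpositions d"
  shows "\<exists>f :: nat \<Rightarrow> nat. (\<forall>x. f (foldr (\<circ>) ts id x) = f x) \<and> d \<le> card (f ` {1..d}) + length ts"
  using assms
proof (induction ts)
  case Nil
  show ?case by (intro exI[of _ id]) simp
next
  case (Cons t ts)
  from Cons.prems have "set ts \<subseteq> transpositions d" by simp
  from Cons.IH[OF this] obtain f :: "nat \<Rightarrow> nat" where f: "\<And>x. f (foldr (\<circ>) ts id x) = f x"
    "d \<le> card (f ` {1..d}) + length ts" by blast
  obtain a b where t: "t = transpose a b" using Cons.prems by (auto simp: transpositions_def)
  define g where "g x = (if f x = f a then f b else f x)" for x
  have "g (t x) = g x" for x by (auto simp: t g_def transpose_def)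
  moreover have "g (foldr (\<circ>) ts id x) = g x" for x by (simp add: g_def f)
  ultimately have inv: "g (foldr (\<circ>) (t # ts) id x) = g x" for x by simp
  have "f ` {1..d} - {f a} \<subseteq> g ` {1..d}" by (auto simp: g_def)
  then have "card (f ` {1..d}) - 1 \<le> card (g ` {1..d})"
    by (metis card_Diff1_le card_Diff_singleton_if card_mono diff_le_self finite_atLeastAtMost
        finite_imageI order_trans card_Diff_singleton Diff_insert0 Diff_empty)
  then have "d \<le> card (g ` {1..d}) + length (t # ts)" using f(2) by simp
  with inv show ?case by blast
qed

text \<open>Upper bound: multiplying \<open>\<sigma>\<close> by the transposition of \<open>a\<close> and \<open>\<sigma> a\<close> makes \<open>a\<close> a fixed
  point, so an invariant function may take a fresh value at \<open>a\<close>. Thus every letter gains a value, and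
  there are only \<open>d\<close> points.\<close>

lemma word_of_invariant_function:
  fixes f :: "nat \<Rightarrow> nat"
  assumes "\<sigma> permutes {1..d}" "\<And>x. x \<in> {1..d} \<Longrightarrow> f (\<sigma> x) = f x"
  shows "\<exists>ts. set ts \<subseteq> transpositions d \<and> foldr (\<circ>) ts id = \<sigma> \<and> length ts + card (f ` {1..d}) \<le> d"
  using assms
proof (induction "card {x \<in> {1..d}. \<sigma> x \<noteq> x}" arbitrary: \<sigma> f rule: less_induct)
  case less
  show ?case
  proof (cases "\<sigma> = id")
    case True
    then show ?thesis
      using card_image_le[of "{1..d}" f] by (intro exI[of _ "[]"]) auto
  next
    case False
    then obtain a where a: "\<sigma> a \<noteq> a" by (auto simp: fun_eq_iff)
    have aI: "a \<in> {1..d}" using a less.prems(1) permutes_not_in by metis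
    have sI: "\<sigma> x \<in> {1..d}" if "x \<in> {1..d}" for x using that permutes_in_image[OF less.prems(1)] by blast
    have inj: "\<sigma> x = \<sigma> y \<longleftrightarrow> x = y" for x y using permutes_inj[OF less.prems(1)] by (auto dest: injD)
    define t where "t = transpose a (\<sigma> a)"
    define \<tau> where "\<tau> = t \<circ> \<sigma>"
    have tI: "t \<in> transpositions d" using aI sI[OF aI] a unfolding transpositions_def t_def by (intro CollectI exI[of _ a] exI[of _ "\<sigma> a"] conjI refl) auto
    have \<tau>: "\<tau> permutes {1..d}"
      unfolding \<tau>_def t_def by (rule permutes_compose[OF less.prems(1) permutes_swap_id[OF aI sI[OF aI]]])
    have \<tau>a: "\<tau> a = a" by (simp add: \<tau>_def t_def)
    have \<tau>x: "\<tau> x = (if \<sigma> x = a then \<sigma> a else \<sigma> x)" if "x \<noteq> a" for x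
      using that inj by (simp add: \<tau>_def t_def transpose_def)
    \<comment> \<open>A value that \<open>f\<close> does not take. Redefining \<open>f\<close> at \<open>a\<close> loses no old value, since \<open>f a\<close> is still
    taken at \<open>\<sigma> a\<close>.\<close>
    define u where "u = Suc (Max (f ` {1..d}))"
    have u: "f x < u" if "x \<in> {1..d}" for x using that by (simp add: u_def le_imp_less_Suc)
    define g where "g = f(a := u)"
    have "g (\<tau> x) = g x" if x: "x \<in> {1..d}" for x
    proof (cases "x = a")
      case False
      then have "\<tau> x \<noteq> a" using \<tau>x a by simp
      then show ?thesis using False less.prems(2)[OF x] less.prems(2)[OF aI] by (auto simp: g_def \<tau>x)
    qed (simp add: \<tau>a)
    moreover have "card {x \<in> {1..d}. \<tau> x \<noteq> x} < card {x \<in> {1..d}. \<sigma> x \<noteq> x}"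
    proof (rule psubset_card_mono)
      have "\<tau> x = x" if "\<sigma> x = x" for x using that \<tau>a \<tau>x a by (cases "x = a") auto
      then show "{x \<in> {1..d}. \<tau> x \<noteq> x} \<subset> {x \<in> {1..d}. \<sigma> x \<noteq> x}"
        using \<tau>a a aI by blast
    qed simp
    ultimately obtain ts where ts: "set ts \<subseteq> transpositions d" "foldr (\<circ>) ts id = \<tau>"
      "length ts + card (g ` {1..d}) \<le> d"
      using less.hyps[OF _ \<tau>, of g] by blast
    have "f ` {1..d} = f ` ({1..d} - {a})"
      using less.prems(2)[OF aI] sI[OF aI] a by (auto simp: image_iff) (metis DiffI singletonD atLeastAtMost_iff)
    then have "g ` {1..d} = insert u (f ` {1..d})"
      using aI by (auto simp: g_def)
    moreover have "u \<notin> f ` {1..d}" using u by blast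
    ultimately have "card (g ` {1..d}) = Suc (card (f ` {1..d}))" by simp
    moreover have "foldr (\<circ>) (t # ts) id = \<sigma>"
      by (simp add: ts(2)) (simp add: \<tau>_def t_def flip: comp_assoc)
    ultimately show ?thesis using ts tI by (intro exI[of _ "t # ts"]) auto
  qed
qed

lemma card_image_invariant_le:
  assumes "\<sigma> permutes A" "finite A" "\<And>x. f (\<sigma> x) = f x"
  shows "card (f ` A) \<le> card (orbit \<sigma> ` A)"
proof -
  have "f ((\<sigma> ^^ n) x) = f x" for n x by (induction n) (simp_all add: assms(3))
  then have "f y = f x" if "y \<in> orbit \<sigma> x" for x y
    using that orbit_powers[OF assms(1,2)] by auto
  then have "f ` orbit \<sigma> x = {f x}" for x using self_in_orbit[OF assms(1,2)] by blast
  then have "f ` A = (\<lambda>Z. the_elem (f ` Z)) ` orbit \<sigma> ` A" by (simp add: image_image)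
  then show ?thesis using assms(2) by (simp add: card_image_le)
qed

text \<open>Both bounds are applied to functions that separate the orbits: the smallest element of the orbit
  of a point is such a function, and no invariant function has more values.\<close>

lemma perm_norm_eq:
  assumes "\<sigma> permutes {1..d}"
  shows "perm_norm d \<sigma> + card (orbit \<sigma> ` {1..d}) = d"
    and "\<exists>ts. length ts = perm_norm d \<sigma> \<and> set ts \<subseteq> transpositions d \<and> foldr (\<circ>) ts id = \<sigma>"
proof -
  let ?P = "\<lambda>n. \<exists>ts. length ts = n \<and> set ts \<subseteq> transpositions d \<and> foldr (\<circ>) ts id = \<sigma>"
  define f where "f x = Min (orbit \<sigma> x)" for x
  have fin: "finite {1..d}" by simp
  have orb: "orbit \<sigma> (\<sigma> x) = orbit \<sigma> x" for x
    by (rule orbit_eq_of_mem[OF assms fin orbit.base])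
  have inj: "inj_on Min (orbit \<sigma> ` {1..d})"
  proof (rule inj_onI, clarify)
    fix x y assume "Min (orbit \<sigma> x) = Min (orbit \<sigma> y)"
    moreover have "Min (orbit \<sigma> z) \<in> orbit \<sigma> z" for z
      by (rule Min_in[OF finite_permutes_orbit[OF assms fin] orbit_nonempty])
    ultimately show "orbit \<sigma> x = orbit \<sigma> y"
      using orbit_eq_of_mem[OF assms fin] by metis
  qed
  have "f ` {1..d} = Min ` orbit \<sigma> ` {1..d}" by (simp add: f_def image_image)
  then have cf: "card (f ` {1..d}) = card (orbit \<sigma> ` {1..d})"
    using card_image[OF inj] by simp
  obtain ts where ts: "set ts \<subseteq> transpositions d" "foldr (\<circ>) ts id = \<sigma>"
    "length ts + card (orbit \<sigma> ` {1..d}) \<le> d"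
    using word_of_invariant_function[OF assms, of f] orb cf by (auto simp: f_def)
  then have P: "?P (length ts)" by blast
  show least: "?P (perm_norm d \<sigma>)" unfolding perm_norm_def by (rule LeastI[of ?P, OF P])
  have "perm_norm d \<sigma> \<le> length ts" unfolding perm_norm_def by (rule Least_le[of ?P, OF P])
  moreover from least obtain ts' where ts': "length ts' = perm_norm d \<sigma>"
    "set ts' \<subseteq> transpositions d" "foldr (\<circ>) ts' id = \<sigma>" by blast
  obtain g :: "nat \<Rightarrow> nat" where g: "\<And>x. g (\<sigma> x) = g x" "d \<le> card (g ` {1..d}) + perm_norm d \<sigma>"
    using invariant_function_of_word[OF ts'(2)] ts' by auto
  ultimately show "perm_norm d \<sigma> + card (orbit \<sigma> ` {1..d}) = d"
    using card_image_invariant_le[OF assms fin, of g] ts(3) by force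
qed

text \<open>Concatenate shortest words. This is what makes the graded product associative.\<close>

lemma perm_norm_comp_le:
  assumes "\<sigma> permutes {1..d}" "\<tau> permutes {1..d}"
  shows "perm_norm d (\<sigma> \<circ> \<tau>) \<le> perm_norm d \<sigma> + perm_norm d \<tau>"
proof -
  obtain ss ts where w: "length ss = perm_norm d \<sigma>" "set ss \<subseteq> transpositions d" "foldr (\<circ>) ss id = \<sigma>"
    "length ts = perm_norm d \<tau>" "set ts \<subseteq> transpositions d" "foldr (\<circ>) ts id = \<tau>"
    using perm_norm_eq(2)[OF assms(1)] perm_norm_eq(2)[OF assms(2)] by auto
  have "foldr (\<circ>) ss f = foldr (\<circ>) ss id \<circ> f" for f :: "nat \<Rightarrow> nat"
    by (induction ss) (auto simp: comp_assoc)
  from this[of \<tau>] have "foldr (\<circ>) (ss @ ts) id = \<sigma> \<circ> \<tau>" using w by simp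
  then have "\<exists>us. length us = length ss + length ts \<and> set us \<subseteq> transpositions d \<and> foldr (\<circ>) us id = \<sigma> \<circ> \<tau>"
    using w by (intro exI[of _ "ss @ ts"]) auto
  then show ?thesis
    unfolding perm_norm_def[of d "\<sigma> \<circ> \<tau>"] w(1)[symmetric] w(4)[symmetric] by (rule Least_le)
qed

lemma perm_norm_id: "perm_norm d id = 0"
  unfolding perm_norm_def by (rule Least_eq_0) auto

lemma cycle_type_conj:
  fixes d :: nat
  assumes "\<sigma> permutes {1..d}" "\<tau> permutes {1..d}"
  shows "cycle_type (\<sigma> \<circ> \<tau> \<circ> inv' \<sigma>) {1..d} = cycle_type \<tau> {1..d}"
proof (rule cycle_type_equivariant[OF assms(2) _ _ permutes_imp_bij[OF assms(1)]])
  show "\<sigma> \<circ> \<tau> \<circ> inv' \<sigma> permutes {1..d}"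
    using assms by (intro permutes_compose permutes_inv)
qed (simp_all add: permutes_inverses[OF assms(1)])

lemma perm_norm_conj:
  assumes "\<sigma> permutes {1..d}" "\<tau> permutes {1..d}"
  shows "perm_norm d (\<sigma> \<circ> \<tau> \<circ> inv' \<sigma>) = perm_norm d \<tau>"
proof -
  have "\<sigma> \<circ> \<tau> \<circ> inv' \<sigma> permutes {1..d}" using assms by (intro permutes_compose permutes_inv)
  from perm_norm_eq(1)[OF this] perm_norm_eq(1)[OF assms(2)]
    arg_cong[OF cycle_type_conj[OF assms], of size]
  show ?thesis by (simp add: size_cycle_type)
qed

section \<open>The commutative graded algebra of class functions\<close>

abbreviation perms :: "nat \<Rightarrow> (nat \<Rightarrow> nat) set" where
  "perms d \<equiv> carrier (sym_group d)"

lemma finite_perms: "finite (perms d)"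
  by (simp add: sym_group_def finite_permutations)

lemma perms_comp: "\<sigma> \<in> perms d \<Longrightarrow> \<tau> \<in> perms d \<Longrightarrow> \<sigma> \<circ> \<tau> \<in> perms d"
  by (simp add: sym_group_carrier permutes_compose)

lemma perms_inv: "\<sigma> \<in> perms d \<Longrightarrow> inv' \<sigma> \<in> perms d"
  by (simp add: sym_group_carrier permutes_inv)

lemma perms_id: "id \<in> perms d"
  by (simp add: sym_group_carrier permutes_id)

lemma perms_inv_o:
  assumes "\<sigma> \<in> perms d"
  shows "inv' \<sigma> \<circ> \<sigma> = id" "\<sigma> \<circ> inv' \<sigma> = id" "inv' \<sigma> (\<sigma> x) = x" "\<sigma> (inv' \<sigma> x) = x"
    "inv' (inv' \<sigma>) = \<sigma>"
  using assms permutes_inv_o[of \<sigma> "{1..d}"] permutes_inverses[of \<sigma> "{1..d}"]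
    permutes_inv_inv[of \<sigma> "{1..d}"]
  by (auto simp: sym_group_carrier)

text \<open>The permutation to which \<open>conj_act\<close> moves a basis vector, named so that its rules do not get
  dissolved by rewriting with composition.\<close>

definition conj_by :: "(nat \<Rightarrow> nat) \<Rightarrow> (nat \<Rightarrow> nat) \<Rightarrow> nat \<Rightarrow> nat" where
  "conj_by \<sigma> \<tau> = \<sigma> \<circ> \<tau> \<circ> inv' \<sigma>"

lemma conj_by_perms: "\<sigma> \<in> perms d \<Longrightarrow> \<tau> \<in> perms d \<Longrightarrow> conj_by \<sigma> \<tau> \<in> perms d"
  by (simp add: conj_by_def perms_comp perms_inv)

lemma conj_by_inv: "\<sigma> \<in> perms d \<Longrightarrow> conj_by \<sigma> (conj_by (inv' \<sigma>) \<tau>) = \<tau>"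
  "\<sigma> \<in> perms d \<Longrightarrow> conj_by (inv' \<sigma>) (conj_by \<sigma> \<tau>) = \<tau>"
  by (simp_all add: conj_by_def fun_eq_iff perms_inv_o)

lemma conj_by_eq_iff: "\<sigma> \<in> perms d \<Longrightarrow> conj_by \<sigma> \<rho> = conj_by \<sigma> \<tau> \<longleftrightarrow> \<rho> = \<tau>"
  by (metis conj_by_inv(2))

lemma conj_by_comp: "\<sigma> \<in> perms d \<Longrightarrow> conj_by \<sigma> \<rho> \<circ> conj_by \<sigma> \<tau> = conj_by \<sigma> (\<rho> \<circ> \<tau>)"
  by (simp add: conj_by_def fun_eq_iff perms_inv_o)

lemma bij_conj_by: "\<sigma> \<in> perms d \<Longrightarrow> bij_betw (conj_by \<sigma>) (perms d) (perms d)"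
  by (rule bij_betw_byWitness[where f' = "conj_by (inv' \<sigma>)"])
    (auto simp: conj_by_inv conj_by_perms perms_inv)

lemma perm_norm_conj_by:
  "\<sigma> \<in> perms d \<Longrightarrow> \<tau> \<in> perms d \<Longrightarrow> perm_norm d (conj_by \<sigma> \<tau>) = perm_norm d \<tau>"
  by (simp add: conj_by_def sym_group_carrier perm_norm_conj)

lemma hilb_coh_simps:
  "mult (hilb_coh d) = graded_mult d" "one (hilb_coh d) = perm_basis id"
  "zero (hilb_coh d) = (\<lambda>_. 0)" "add (hilb_coh d) = (\<lambda>f g \<sigma>. f \<sigma> + g \<sigma>)"
  "smult (hilb_coh d) = (\<lambda>c f \<sigma>. c * f \<sigma>)"
  by (simp_all add: hilb_coh_def graded_group_algebra_def)

lemma conj_act_conj_by: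
  assumes "\<sigma> \<in> perms d" "\<tau> \<in> perms d"
  shows "conj_act d \<sigma> f (conj_by \<sigma> \<tau>) = f \<tau>"
proof -
  have "conj_act d \<sigma> f (conj_by \<sigma> \<tau>) = (\<Sum>\<tau>'\<in>perms d. if \<tau> = \<tau>' then f \<tau>' else 0)"
    using conj_by_eq_iff[OF assms(1)]
    unfolding conj_act_def conj_by_def perm_basis_def by (intro sum.cong) auto
  then show ?thesis using assms(2) by (simp add: finite_perms)
qed

text \<open>Conjugation permutes the basis vectors, so invariance is constancy of the coefficients on conjugacy
  classes.\<close>

lemma hilb_coh_carrier:
  "f \<in> carrier (hilb_coh d) \<longleftrightarrow>
    (\<forall>\<sigma>. \<sigma> \<notin> perms d \<longrightarrow> f \<sigma> = 0) \<and> (\<forall>\<sigma>\<in>perms d. \<forall>\<tau>\<in>perms d. f (conj_by \<sigma> \<tau>) = f \<tau>)"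
proof -
  have "conj_act d \<sigma> f = f \<longleftrightarrow> (\<forall>\<tau>\<in>perms d. f (conj_by \<sigma> \<tau>) = f \<tau>)"
    if f: "\<forall>\<sigma>. \<sigma> \<notin> perms d \<longrightarrow> f \<sigma> = 0" and \<sigma>: "\<sigma> \<in> perms d" for \<sigma>
  proof
    assume "conj_act d \<sigma> f = f"
    then show "\<forall>\<tau>\<in>perms d. f (conj_by \<sigma> \<tau>) = f \<tau>" using conj_act_conj_by[OF \<sigma>] by metis
  next
    assume inv: "\<forall>\<tau>\<in>perms d. f (conj_by \<sigma> \<tau>) = f \<tau>"
    show "conj_act d \<sigma> f = f"
    proof
      fix \<rho>
      show "conj_act d \<sigma> f \<rho> = f \<rho>"
      proof (cases "\<rho> \<in> perms d")
        case True
        define \<tau> where "\<tau> = conj_by (inv' \<sigma>) \<rho>"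
        have "\<tau> \<in> perms d" "\<rho> = conj_by \<sigma> \<tau>"
          using True \<sigma> by (simp_all add: \<tau>_def conj_by_perms perms_inv conj_by_inv)
        then show ?thesis using conj_act_conj_by[OF \<sigma>] inv by simp
      next
        case False
        then have "\<rho> \<noteq> \<sigma> \<circ> \<tau> \<circ> inv' \<sigma>" if "\<tau> \<in> perms d" for \<tau>
          using conj_by_perms[OF \<sigma> that] by (auto simp: conj_by_def)
        then show ?thesis using f False by (simp add: conj_act_def perm_basis_def)
      qed
    qed
  qed
  then show ?thesis by (auto simp: hilb_coh_def graded_group_algebra_def)
qed

lemma basis_prod_apply:
  "basis_prod d \<sigma> \<tau> \<rho> =
    (if \<rho> = \<sigma> \<circ> \<tau> \<and> perm_norm d \<rho> = perm_norm d \<sigma> + perm_norm d \<tau> then 1 else 0)"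
  by (simp add: basis_prod_def perm_basis_def)

lemma basis_prod_conj_by:
  assumes "\<pi> \<in> perms d" "\<sigma> \<in> perms d" "\<tau> \<in> perms d"
  shows "basis_prod d (conj_by \<pi> \<sigma>) (conj_by \<pi> \<tau>) (conj_by \<pi> \<rho>) = basis_prod d \<sigma> \<tau> \<rho>"
proof (cases "\<rho> = \<sigma> \<circ> \<tau>")
  case True
  then show ?thesis
    by (simp add: basis_prod_apply conj_by_comp[OF assms(1)] perm_norm_conj_by assms perms_comp)
next
  case False
  then show ?thesis by (simp add: basis_prod_apply conj_by_comp[OF assms(1)] conj_by_eq_iff[OF assms(1)])
qed

lemma graded_mult_closed:
  assumes f: "f \<in> carrier (hilb_coh d)" and g: "g \<in> carrier (hilb_coh d)"
  shows "graded_mult d f g \<in> carrier (hilb_coh d)"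
  unfolding hilb_coh_carrier
proof (intro conjI allI ballI impI)
  fix \<rho> assume "\<rho> \<notin> perms d"
  then have "basis_prod d \<sigma> \<tau> \<rho> = 0" if "\<sigma> \<in> perms d" "\<tau> \<in> perms d" for \<sigma> \<tau>
    using perms_comp[OF that] by (auto simp: basis_prod_apply)
  then show "graded_mult d f g \<rho> = 0" by (simp add: graded_mult_def)
next
  fix \<pi> \<rho> assume \<pi>: "\<pi> \<in> perms d" and "\<rho> \<in> perms d"
  let ?c = "conj_by \<pi>"
  have reindex: "sum h (perms d) = (\<Sum>\<sigma>\<in>perms d. h (?c \<sigma>))" for h :: "_ \<Rightarrow> rat"
    by (rule sum.reindex_bij_betw[OF bij_conj_by[OF \<pi>], symmetric])
  have "graded_mult d f g (?c \<rho>) =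
    (\<Sum>\<sigma>\<in>perms d. \<Sum>\<tau>\<in>perms d. f (?c \<sigma>) * g (?c \<tau>) * basis_prod d (?c \<sigma>) (?c \<tau>) (?c \<rho>))"
    unfolding graded_mult_def
    by (rule trans[OF reindex], rule sum.cong[OF refl], rule reindex)
  also have "\<dots> = graded_mult d f g \<rho>"
    unfolding graded_mult_def
    using f g \<pi> by (intro sum.cong refl) (simp add: hilb_coh_carrier basis_prod_conj_by)
  finally show "graded_mult d f g (?c \<rho>) = graded_mult d f g \<rho>" .
qed

text \<open>Since \<open>\<sigma> \<tau> = \<tau> (\<tau>\<inverse> \<sigma> \<tau>)\<close>, a class function commutes with every basis
  vector; the norm condition is unaffected because the norm is invariant under conjugation.\<close>

lemma graded_mult_comm:
  assumes f: "f \<in> carrier (hilb_coh d)"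
  shows "graded_mult d f g = graded_mult d g f"
proof
  fix \<rho>
  have inner: "(\<Sum>\<sigma>\<in>perms d. f \<sigma> * g \<tau> * basis_prod d \<sigma> \<tau> \<rho>) =
    (\<Sum>\<sigma>\<in>perms d. g \<tau> * f \<sigma> * basis_prod d \<tau> \<sigma> \<rho>)" if \<tau>: "\<tau> \<in> perms d" for \<tau>
  proof -
    have "conj_by \<tau> \<sigma> \<circ> \<tau> = \<tau> \<circ> \<sigma>" for \<sigma>
      by (simp add: conj_by_def fun_eq_iff perms_inv_o[OF \<tau>])
    then have bp: "basis_prod d (conj_by \<tau> \<sigma>) \<tau> \<rho> = basis_prod d \<tau> \<sigma> \<rho>" if "\<sigma> \<in> perms d" for \<sigma>
      using perm_norm_conj_by[OF \<tau> that] by (simp add: basis_prod_apply add.commute)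
    have "(\<Sum>\<sigma>\<in>perms d. f \<sigma> * g \<tau> * basis_prod d \<sigma> \<tau> \<rho>) =
      (\<Sum>\<sigma>\<in>perms d. f (conj_by \<tau> \<sigma>) * g \<tau> * basis_prod d (conj_by \<tau> \<sigma>) \<tau> \<rho>)"
      by (rule sum.reindex_bij_betw[OF bij_conj_by[OF \<tau>], symmetric])
    also have "\<dots> = (\<Sum>\<sigma>\<in>perms d. g \<tau> * f \<sigma> * basis_prod d \<tau> \<sigma> \<rho>)"
      using f \<tau> by (intro sum.cong refl) (simp add: hilb_coh_carrier bp)
    finally show ?thesis .
  qed
  have "graded_mult d f g \<rho> = (\<Sum>\<tau>\<in>perms d. \<Sum>\<sigma>\<in>perms d. f \<sigma> * g \<tau> * basis_prod d \<sigma> \<tau> \<rho>)"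
    unfolding graded_mult_def by (rule sum.swap)
  then show "graded_mult d f g \<rho> = graded_mult d g f \<rho>"
    by (simp add: inner graded_mult_def)
qed

text \<open>The coefficient of \<open>[\<rho>]\<close> in the product of three basis vectors, in a form that does not depend on
  the bracketing.\<close>

definition triple_prod :: "nat \<Rightarrow> (nat \<Rightarrow> nat) \<Rightarrow> (nat \<Rightarrow> nat) \<Rightarrow> (nat \<Rightarrow> nat) \<Rightarrow> perm_vec" where
  "triple_prod d \<alpha> \<beta> \<gamma> \<rho> =
    (if \<rho> = \<alpha> \<circ> \<beta> \<circ> \<gamma> \<and> perm_norm d \<rho> = perm_norm d \<alpha> + perm_norm d \<beta> + perm_norm d \<gamma> then 1 else 0)"

text \<open>Both factors are non-zero exactly if the norm is additive on the whole product: by subadditivity, a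
  loss of norm in one step cannot be made up in the other.\<close>

lemma triple_prod_left:
  assumes "\<alpha> \<in> perms d" "\<beta> \<in> perms d" "\<gamma> \<in> perms d"
  shows "(\<Sum>\<sigma>\<in>perms d. basis_prod d \<alpha> \<beta> \<sigma> * basis_prod d \<sigma> \<gamma> \<rho>) = triple_prod d \<alpha> \<beta> \<gamma> \<rho>"
proof -
  have "(\<Sum>\<sigma>\<in>perms d. basis_prod d \<alpha> \<beta> \<sigma> * basis_prod d \<sigma> \<gamma> \<rho>) =
    (\<Sum>\<sigma>\<in>perms d. if \<alpha> \<circ> \<beta> = \<sigma> then basis_prod d \<alpha> \<beta> \<sigma> * basis_prod d \<sigma> \<gamma> \<rho> else 0)"
    by (intro sum.cong) (auto simp: basis_prod_apply)
  also have "\<dots> = basis_prod d \<alpha> \<beta> (\<alpha> \<circ> \<beta>) * basis_prod d (\<alpha> \<circ> \<beta>) \<gamma> \<rho>"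
    using assms by (simp add: finite_perms perms_comp)
  also have "\<dots> = triple_prod d \<alpha> \<beta> \<gamma> \<rho>"
    using perm_norm_comp_le[of \<alpha> d \<beta>] perm_norm_comp_le[of "\<alpha> \<circ> \<beta>" d \<gamma>] assms perms_comp[of \<alpha> d \<beta>]
    by (auto simp: basis_prod_apply triple_prod_def sym_group_carrier)
  finally show ?thesis .
qed

lemma triple_prod_right:
  assumes "\<alpha> \<in> perms d" "\<beta> \<in> perms d" "\<gamma> \<in> perms d"
  shows "(\<Sum>\<sigma>\<in>perms d. basis_prod d \<beta> \<gamma> \<sigma> * basis_prod d \<alpha> \<sigma> \<rho>) = triple_prod d \<alpha> \<beta> \<gamma> \<rho>"
proof -
  have "(\<Sum>\<sigma>\<in>perms d. basis_prod d \<beta> \<gamma> \<sigma> * basis_prod d \<alpha> \<sigma> \<rho>) =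
    (\<Sum>\<sigma>\<in>perms d. if \<beta> \<circ> \<gamma> = \<sigma> then basis_prod d \<beta> \<gamma> \<sigma> * basis_prod d \<alpha> \<sigma> \<rho> else 0)"
    by (intro sum.cong) (auto simp: basis_prod_apply)
  also have "\<dots> = basis_prod d \<beta> \<gamma> (\<beta> \<circ> \<gamma>) * basis_prod d \<alpha> (\<beta> \<circ> \<gamma>) \<rho>"
    using assms by (simp add: finite_perms perms_comp)
  also have "\<dots> = triple_prod d \<alpha> \<beta> \<gamma> \<rho>"
    using perm_norm_comp_le[of \<beta> d \<gamma>] perm_norm_comp_le[of \<alpha> d "\<beta> \<circ> \<gamma>"] assms perms_comp[of \<beta> d \<gamma>]
    by (auto simp: basis_prod_apply triple_prod_def sym_group_carrier comp_assoc)
  finally show ?thesis .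
qed

lemma graded_mult_assoc: "graded_mult d (graded_mult d f g) h = graded_mult d f (graded_mult d g h)"
proof
  fix \<rho>
  let ?S = "perms d"
  have "graded_mult d (graded_mult d f g) h \<rho> =
    (\<Sum>\<sigma>\<in>?S. \<Sum>\<gamma>\<in>?S. \<Sum>\<alpha>\<in>?S. \<Sum>\<beta>\<in>?S.
       f \<alpha> * g \<beta> * h \<gamma> * (basis_prod d \<alpha> \<beta> \<sigma> * basis_prod d \<sigma> \<gamma> \<rho>))"
    unfolding graded_mult_def by (simp add: sum_distrib_right sum_distrib_left mult_ac)
  also have "\<dots> = (\<Sum>\<gamma>\<in>?S. \<Sum>\<sigma>\<in>?S. \<Sum>\<alpha>\<in>?S. \<Sum>\<beta>\<in>?S.
       f \<alpha> * g \<beta> * h \<gamma> * (basis_prod d \<alpha> \<beta> \<sigma> * basis_prod d \<sigma> \<gamma> \<rho>))"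
    by (rule sum.swap)
  also have "\<dots> = (\<Sum>\<gamma>\<in>?S. \<Sum>\<alpha>\<in>?S. \<Sum>\<sigma>\<in>?S. \<Sum>\<beta>\<in>?S.
       f \<alpha> * g \<beta> * h \<gamma> * (basis_prod d \<alpha> \<beta> \<sigma> * basis_prod d \<sigma> \<gamma> \<rho>))"
    by (rule sum.cong[OF refl sum.swap])
  also have "\<dots> = (\<Sum>\<gamma>\<in>?S. \<Sum>\<alpha>\<in>?S. \<Sum>\<beta>\<in>?S. \<Sum>\<sigma>\<in>?S.
       f \<alpha> * g \<beta> * h \<gamma> * (basis_prod d \<alpha> \<beta> \<sigma> * basis_prod d \<sigma> \<gamma> \<rho>))"
    by (rule sum.cong[OF refl], rule sum.cong[OF refl], rule sum.swap)
  also have "\<dots> = (\<Sum>\<gamma>\<in>?S. \<Sum>\<alpha>\<in>?S. \<Sum>\<beta>\<in>?S. f \<alpha> * g \<beta> * h \<gamma> * triple_prod d \<alpha> \<beta> \<gamma> \<rho>)"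
    by (intro sum.cong[OF refl]) (simp add: sum_distrib_left[symmetric] triple_prod_left)
  also have "\<dots> = (\<Sum>\<alpha>\<in>?S. \<Sum>\<gamma>\<in>?S. \<Sum>\<beta>\<in>?S. f \<alpha> * g \<beta> * h \<gamma> * triple_prod d \<alpha> \<beta> \<gamma> \<rho>)"
    by (rule sum.swap)
  also have "\<dots> = (\<Sum>\<alpha>\<in>?S. \<Sum>\<beta>\<in>?S. \<Sum>\<gamma>\<in>?S. f \<alpha> * g \<beta> * h \<gamma> * triple_prod d \<alpha> \<beta> \<gamma> \<rho>)"
    by (rule sum.cong[OF refl sum.swap])
  also have "\<dots> = (\<Sum>\<alpha>\<in>?S. \<Sum>\<beta>\<in>?S. \<Sum>\<gamma>\<in>?S. \<Sum>\<sigma>\<in>?S.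
       f \<alpha> * g \<beta> * h \<gamma> * (basis_prod d \<beta> \<gamma> \<sigma> * basis_prod d \<alpha> \<sigma> \<rho>))"
    by (intro sum.cong[OF refl]) (simp add: sum_distrib_left[symmetric] triple_prod_right)
  also have "\<dots> = (\<Sum>\<alpha>\<in>?S. \<Sum>\<beta>\<in>?S. \<Sum>\<sigma>\<in>?S. \<Sum>\<gamma>\<in>?S.
       f \<alpha> * g \<beta> * h \<gamma> * (basis_prod d \<beta> \<gamma> \<sigma> * basis_prod d \<alpha> \<sigma> \<rho>))"
    by (rule sum.cong[OF refl], rule sum.cong[OF refl], rule sum.swap)
  also have "\<dots> = (\<Sum>\<alpha>\<in>?S. \<Sum>\<sigma>\<in>?S. \<Sum>\<beta>\<in>?S. \<Sum>\<gamma>\<in>?S.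
       f \<alpha> * g \<beta> * h \<gamma> * (basis_prod d \<beta> \<gamma> \<sigma> * basis_prod d \<alpha> \<sigma> \<rho>))"
    by (rule sum.cong[OF refl sum.swap])
  also have "\<dots> = graded_mult d f (graded_mult d g h) \<rho>"
    unfolding graded_mult_def by (simp add: sum_distrib_right sum_distrib_left mult_ac)
  finally show "graded_mult d (graded_mult d f g) h \<rho> = graded_mult d f (graded_mult d g h) \<rho>" .
qed

lemma perm_basis_id_carrier: "perm_basis id \<in> carrier (hilb_coh d)"
proof -
  have "conj_by \<sigma> \<tau> = id \<longleftrightarrow> \<tau> = id" if \<sigma>: "\<sigma> \<in> perms d" for \<sigma> \<tau>
    using conj_by_eq_iff[OF \<sigma>, of \<tau> id] by (simp add: conj_by_def perms_inv_o[OF \<sigma>])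
  then show ?thesis using perms_id[of d] by (auto simp: hilb_coh_carrier perm_basis_def)
qed

lemma graded_mult_one:
  assumes "f \<in> carrier (hilb_coh d)"
  shows "graded_mult d (perm_basis id) f = f"
proof
  fix \<rho>
  have "graded_mult d (perm_basis id) f \<rho> =
    (\<Sum>\<sigma>\<in>perms d. if id = \<sigma> then (\<Sum>\<tau>\<in>perms d. if \<rho> = \<tau> then f \<tau> else 0) else 0)"
    unfolding graded_mult_def
    by (intro sum.cong refl) (auto simp: perm_basis_def basis_prod_apply perm_norm_id intro!: sum.cong)
  then show "graded_mult d (perm_basis id) f \<rho> = f \<rho>"
    using assms by (auto simp: finite_perms perms_id hilb_coh_carrier)
qed

text \<open>With this, products over index sets and powers in the cohomology obey the usual rules.\<close>

lemma comm_monoid_hilb_coh: "comm_monoid (hilb_coh d)"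
proof (rule comm_monoidI)
  fix f g assume "f \<in> carrier (hilb_coh d)" "g \<in> carrier (hilb_coh d)"
  then show "f \<otimes>\<^bsub>hilb_coh d\<^esub> g \<in> carrier (hilb_coh d)" "f \<otimes>\<^bsub>hilb_coh d\<^esub> g = g \<otimes>\<^bsub>hilb_coh d\<^esub> f"
    by (simp_all add: hilb_coh_simps graded_mult_closed graded_mult_comm)
qed (simp_all add: hilb_coh_simps graded_mult_assoc graded_mult_one perm_basis_id_carrier)

lemma abelian_monoid_hilb_coh: "abelian_monoid (hilb_coh d)"
  by (rule abelian_monoidI) (auto simp: hilb_coh_simps hilb_coh_carrier add_ac fun_eq_iff)

lemma coh_homogeneous_one: "coh_homogeneous d 0 \<one>\<^bsub>hilb_coh d\<^esub>"
  by (simp add: coh_homogeneous_def hilb_coh_simps perm_basis_id_carrier)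
    (simp add: perm_basis_def perm_norm_id)

lemma coh_homogeneous_mult:
  assumes "coh_homogeneous d i f" "coh_homogeneous d j g"
  shows "coh_homogeneous d (i + j) (f \<otimes>\<^bsub>hilb_coh d\<^esub> g)"
  unfolding coh_homogeneous_def
proof (intro conjI allI impI)
  show "f \<otimes>\<^bsub>hilb_coh d\<^esub> g \<in> carrier (hilb_coh d)"
    using assms by (simp add: coh_homogeneous_def hilb_coh_simps graded_mult_closed)
  fix \<rho> assume "(f \<otimes>\<^bsub>hilb_coh d\<^esub> g) \<rho> \<noteq> 0"
  then obtain \<sigma> where "(\<Sum>\<tau>\<in>perms d. f \<sigma> * g \<tau> * basis_prod d \<sigma> \<tau> \<rho>) \<noteq> 0"
    unfolding hilb_coh_simps graded_mult_def by (rule sum.not_neutral_contains_not_neutral)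
  then obtain \<tau> where "f \<sigma> * g \<tau> * basis_prod d \<sigma> \<tau> \<rho> \<noteq> 0"
    by (rule sum.not_neutral_contains_not_neutral)
  then show "perm_norm d \<rho> = i + j"
    using assms by (auto simp: coh_homogeneous_def basis_prod_apply split: if_splits)
qed

lemma coh_homogeneous_pow:
  assumes "coh_homogeneous d i f"
  shows "coh_homogeneous d (i * n) (f [^]\<^bsub>hilb_coh d\<^esub> n)"
proof (induction n)
  case (Suc n)
  from coh_homogeneous_mult[OF this assms] show ?case
    by (simp add: nat_pow_def add.commute)
qed (simp add: nat_pow_def coh_homogeneous_one)

lemma coh_homogeneous_finprod:
  assumes "finite A" "\<And>j. j \<in> A \<Longrightarrow> coh_homogeneous d (w j) (f j)"
  shows "coh_homogeneous d (\<Sum>j\<in>A. w j) (\<Otimes>\<^bsub>hilb_coh d\<^esub>j\<in>A. f j)"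
  using assms
proof (induction A rule: finite_induct)
  case empty
  interpret comm_monoid "hilb_coh d" by (rule comm_monoid_hilb_coh)
  show ?case by (simp add: coh_homogeneous_one)
next
  case (insert j A)
  interpret comm_monoid "hilb_coh d" by (rule comm_monoid_hilb_coh)
  have car: "f i \<in> carrier (hilb_coh d)" if "i \<in> insert j A" for i
    using insert.prems[OF that] by (simp add: coh_homogeneous_def)
  have "(\<Otimes>\<^bsub>hilb_coh d\<^esub>i\<in>insert j A. f i) = f j \<otimes>\<^bsub>hilb_coh d\<^esub> (\<Otimes>\<^bsub>hilb_coh d\<^esub>i\<in>A. f i)"
    using insert.hyps car by (intro finprod_insert) auto
  then show ?case
    using coh_homogeneous_mult[OF insert.prems insert.IH, of j] insert by simp
qed

lemma finsum_hilb_coh: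
  assumes "finite A" "\<And>a. a \<in> A \<Longrightarrow> f a \<in> carrier (hilb_coh d)"
  shows "(\<Oplus>\<^bsub>hilb_coh d\<^esub>a\<in>A. f a) = (\<lambda>\<sigma>. \<Sum>a\<in>A. f a \<sigma>)"
  using assms
proof (induction A rule: finite_induct)
  case empty
  interpret abelian_monoid "hilb_coh d" by (rule abelian_monoid_hilb_coh)
  show ?case by (simp add: hilb_coh_simps)
next
  case (insert a A)
  interpret abelian_monoid "hilb_coh d" by (rule abelian_monoid_hilb_coh)
  show ?case
    using insert by (simp add: hilb_coh_simps Pi_def)
qed

section \<open>Dimensions by coordinates and the rank-nullity theorem\<close>

text \<open>A family with unique coordinates counts dimension. It is used for the monomials and for the
  indicator functions of conjugacy classes.\<close>

lemma (in vector_space) dim_eq_card_coordinates: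
  assumes "finite I" "v ` I \<subseteq> V"
    and span: "\<And>w. w \<in> V \<Longrightarrow> w = (\<Sum>i\<in>I. scale (\<phi> w i) (v i))"
    and indep: "\<And>c i. (\<Sum>i\<in>I. scale (c i) (v i)) = 0 \<Longrightarrow> i \<in> I \<Longrightarrow> c i = 0"
  shows "dim V = card I" and "V \<subseteq> span (v ` I)"
proof -
  have inj: "inj_on v I"
  proof (rule inj_onI, rule ccontr)
    fix i j assume ij: "i \<in> I" "j \<in> I" "v i = v j" "i \<noteq> j"
    let ?c = "\<lambda>k. if k = i then 1 else if k = j then - 1 else 0"
    have "(\<Sum>k\<in>I. scale (?c k) (v k)) = (\<Sum>k\<in>{i, j}. scale (?c k) (v k))"
      using ij assms(1) by (intro sum.mono_neutral_right) auto
    also have "\<dots> = 0" using ij by simp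
    finally show False using indep[of ?c i] ij by simp
  qed
  show V: "V \<subseteq> span (v ` I)"
    by (rule subsetI, subst span) (auto intro: span_sum span_scale span_base)
  have "independent (v ` I)"
  proof (rule independent_if_scalars_zero)
    fix f w assume "(\<Sum>x\<in>v ` I. scale (f x) x) = 0" "w \<in> v ` I"
    then show "f w = 0" using indep[of "f \<circ> v"] by (auto simp: sum.reindex[OF inj])
  qed (use assms(1) in simp)
  then have "card (v ` I) = dim V" using assms(2) V basis_card_eq_dim by blast
  then show "dim V = card I" using card_image[OF inj] by simp
qed

text \<open>Rank and nullity of a linear map on a finite-dimensional subspace of a possibly infinite-dimensional
  space: extend a basis \<open>B\<close> of the kernel to a basis \<open>C\<close> of the subspace; the new vectors map
  bijectively to a basis of the image.\<close>

lemma dim_kernel_add_dim_image: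
  assumes "Vector_Spaces.linear s1 s2 f"
    and "module.subspace s1 V" "V \<subseteq> module.span s1 S" "finite S"
  shows "vector_space.dim s1 {v \<in> V. f v = 0} + vector_space.dim s2 (f ` V) = vector_space.dim s1 V"
proof -
  interpret Vector_Spaces.linear s1 s2 f by fact
  interpret vector_space_pair s1 s2 by unfold_locales
  define K where "K = {v \<in> V. f v = 0}"
  obtain B where B: "B \<subseteq> K" "vs1.independent B" "K \<subseteq> vs1.span B" "card B = vs1.dim K"
    using vs1.basis_exists by blast
  have "B \<subseteq> V" using B(1) by (auto simp: K_def)
  then obtain C where C: "B \<subseteq> C" "C \<subseteq> V" "vs1.independent C" "V \<subseteq> vs1.span C"
    using vs1.maximal_independent_subset_extend B(2) by blast
  have finC: "finite C" using vs1.independent_span_bound[OF assms(4) C(3)] C(2) assms(3) by blast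
  define D where "D = C - B"
  have spanC: "vs1.span C = V" using C assms(2) vs1.span_subspace by blast
  have indD: "vs1.independent D" using C(3) vs1.independent_mono by (auto simp: D_def)
  have "f ` C \<subseteq> insert 0 (f ` D)" using B(1) by (auto simp: D_def K_def)
  then have "vs2.span (f ` C) \<subseteq> vs2.span (f ` D)"
    using vs2.span_mono[of "f ` C" "insert 0 (f ` D)"] by simp
  then have spanD: "f ` V \<subseteq> vs2.span (f ` D)" using span_image[of C] spanC by simp
  \<comment> \<open>A vector in the span of both \<open>B\<close> and \<open>D\<close> has its coordinates with respect to \<open>C\<close>
  supported in both of these disjoint sets.\<close>
  have "v = 0" if v: "v \<in> vs1.span D" "f v = 0" for v
  proof -
    have "v \<in> V" using v(1) vs1.span_mono[of D C] spanC by (auto simp: D_def)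
    then have vB: "v \<in> vs1.span B" using v B(3) by (auto simp: K_def)
    have "vs1.representation C v = vs1.representation B v"
      using vs1.representation_extend[OF C(3) vB C(1)] .
    moreover have "vs1.representation C v = vs1.representation D v"
      using vs1.representation_extend[OF C(3) v(1)] by (simp add: D_def)
    ultimately have "vs1.representation C v b = 0" for b
      using vs1.representation_ne_zero[of B v b] vs1.representation_ne_zero[of D v b]
      by (auto simp: D_def)
    then show ?thesis
      using vs1.sum_nonzero_representation_eq[OF C(3), of v] v(1) vs1.span_mono[of D C]
      by (auto simp: D_def)
  qed
  then have inj: "inj_on f (vs1.span D)"
    using linear_inj_on_iff_eq_0[OF assms(1) vs1.subspace_span] by blast
  then have "vs2.independent (f ` D)"
    using linear_independent_injective_image[OF assms(1) indD] by blast
  moreover have "f ` D \<subseteq> f ` V" using C(2) by (auto simp: D_def)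
  ultimately have "card (f ` D) = vs2.dim (f ` V)" using spanD vs2.basis_card_eq_dim by blast
  moreover have "card (f ` D) = card D"
    using inj vs1.span_superset inj_on_subset card_image by metis
  moreover have "card C = vs1.dim V" using C vs1.basis_card_eq_dim by blast
  moreover have "card D + card B = card C"
    using finC C(1) by (simp add: D_def card_Diff_subset finite_subset card_mono)
  ultimately show ?thesis using B(4) by (simp add: K_def)
qed

section \<open>Evaluation of polynomials respects norms\<close>

definition monomial_value :: "nat \<Rightarrow> nat \<Rightarrow> (nat \<Rightarrow> perm_vec) \<Rightarrow> monomial \<Rightarrow> perm_vec" where
  "monomial_value d m x a = (\<Otimes>\<^bsub>hilb_coh d\<^esub>j\<in>{1..m}. x j [^]\<^bsub>hilb_coh d\<^esub> Poly_Mapping.lookup a j)"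

text \<open>The sum runs over all of \<open>{1..m}\<close> because variables beyond \<open>X\<^sub>m\<close> in a monomial are ignored by the
  evaluation; so every monomial has a value in the algebra.\<close>

lemma coh_homogeneous_monomial_value:
  assumes "\<And>j. j \<in> {1..m} \<Longrightarrow> coh_homogeneous d j (x j)"
  shows "coh_homogeneous d (\<Sum>j\<in>{1..m}. j * Poly_Mapping.lookup a j) (monomial_value d m x a)"
  unfolding monomial_value_def
  using assms by (intro coh_homogeneous_finprod coh_homogeneous_pow) auto

lemma monomial_value_norm:
  assumes "\<And>j. j \<in> {1..m} \<Longrightarrow> coh_homogeneous d j (x j)" "Poly_Mapping.keys a \<subseteq> {1..m}"
  shows "coh_homogeneous d (mono_norm a) (monomial_value d m x a)"
  using coh_homogeneous_monomial_value[OF assms(1), of m]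
  by (simp add: mono_norm_superset[OF assms(2)])

lemma hilb_coh_smult_closed:
  "f \<in> carrier (hilb_coh d) \<Longrightarrow> c \<odot>\<^bsub>hilb_coh d\<^esub> f \<in> carrier (hilb_coh d)"
  by (simp add: hilb_coh_simps hilb_coh_carrier)

lemma eval_hom_sum:
  assumes "\<And>j. j \<in> {1..m} \<Longrightarrow> coh_homogeneous d j (x j)"
    and "finite K" "Poly_Mapping.keys p \<subseteq> K"
  shows "eval_hom d m x p = (\<lambda>\<sigma>. \<Sum>a\<in>K. Poly_Mapping.lookup p a * monomial_value d m x a \<sigma>)"
proof -
  have "monomial_value d m x a \<in> carrier (hilb_coh d)" for a
    using coh_homogeneous_monomial_value[OF assms(1), of m] by (simp add: coh_homogeneous_def)
  then have "eval_hom d m x p =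
    (\<lambda>\<sigma>. \<Sum>a\<in>Poly_Mapping.keys p. Poly_Mapping.lookup p a * monomial_value d m x a \<sigma>)"
    unfolding eval_hom_def monomial_value_def[symmetric]
    by (subst finsum_hilb_coh) (simp_all add: hilb_coh_simps hilb_coh_smult_closed[unfolded hilb_coh_simps])
  also have "\<dots> = (\<lambda>\<sigma>. \<Sum>a\<in>K. Poly_Mapping.lookup p a * monomial_value d m x a \<sigma>)"
    using assms by (intro ext sum.mono_neutral_left) (auto simp: in_keys_iff)
  finally show ?thesis .
qed

lemma lookup_scalar_mult [simp]:
  "Poly_Mapping.lookup (scalar_mult c p) a = c * Poly_Mapping.lookup p a"
  by (simp add: scalar_mult_def mult_map_scale_conv_mult[symmetric] Poly_Mapping.map.rep_eq when_def)

interpretation mpoly: vector_space scalar_mult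
  by unfold_locales (auto intro!: poly_mapping_eqI simp: lookup_add algebra_simps)

definition vec_scale :: "rat \<Rightarrow> perm_vec \<Rightarrow> perm_vec" where
  "vec_scale c f = (\<lambda>\<sigma>. c * f \<sigma>)"

interpretation pvec: vector_space vec_scale
  by unfold_locales (auto simp: vec_scale_def fun_eq_iff algebra_simps)

text \<open>Linearity on all polynomials, not just those in \<open>X\<^sub>1, \<dots>, X\<^sub>m\<close>, makes the theory of linear maps
  between whole types applicable.\<close>

lemma linear_eval_hom:
  assumes "\<And>j. j \<in> {1..m} \<Longrightarrow> coh_homogeneous d j (x j)"
  shows "Vector_Spaces.linear scalar_mult vec_scale (eval_hom d m x)"
  unfolding Vector_Spaces.linear_iff
proof (intro conjI allI)
  have eval: "eval_hom d m x r =
      (\<lambda>\<sigma>. \<Sum>a\<in>K. Poly_Mapping.lookup r a * monomial_value d m x a \<sigma>)"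
    if "finite K" "Poly_Mapping.keys r \<subseteq> K" for K r
    using assms that by (intro eval_hom_sum) auto
  fix p q :: rat_mpoly
  let ?K = "Poly_Mapping.keys p \<union> Poly_Mapping.keys q"
  have "Poly_Mapping.keys (p + q) \<subseteq> ?K" by (rule Poly_Mapping.keys_add)
  then show "eval_hom d m x (p + q) = eval_hom d m x p + eval_hom d m x q"
    by (simp add: eval[of ?K] fun_eq_iff lookup_add algebra_simps sum.distrib)
  fix c
  have "Poly_Mapping.keys (scalar_mult c p) \<subseteq> Poly_Mapping.keys p" by (auto simp: in_keys_iff)
  then show "eval_hom d m x (scalar_mult c p) = vec_scale c (eval_hom d m x p)"
    by (simp add: eval[of "Poly_Mapping.keys p"] vec_scale_def fun_eq_iff sum_distrib_left mult_ac)
qed unfold_locales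

definition norm_component :: "nat \<Rightarrow> rat_mpoly \<Rightarrow> rat_mpoly" where
  "norm_component n p = Poly_Mapping.mapp (\<lambda>a c. c when mono_norm a = n) p"

lemma lookup_norm_component:
  "Poly_Mapping.lookup (norm_component n p) a = (Poly_Mapping.lookup p a when mono_norm a = n)"
  by (auto simp: norm_component_def lookup_mapp in_keys_iff when_def)

lemma keys_norm_component:
  "Poly_Mapping.keys (norm_component n p) = {a \<in> Poly_Mapping.keys p. mono_norm a = n}"
  by (auto simp: in_keys_iff lookup_norm_component when_def split: if_splits)

lemma norm_component_homogeneous:
  assumes "homogeneous k p"
  shows "norm_component n p = (if n = k then p else 0)"
proof (rule poly_mapping_eqI)
  fix a
  show "Poly_Mapping.lookup (norm_component n p) a = Poly_Mapping.lookup (if n = k then p else 0) a"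
    using assms by (cases "a \<in> Poly_Mapping.keys p")
      (auto simp: lookup_norm_component homogeneous_def in_keys_iff when_def)
qed

lemma norm_component_in_graded_part:
  "p \<in> poly_ring m \<Longrightarrow> norm_component n p \<in> graded_part n (poly_ring m)"
  by (auto simp: graded_part_def poly_ring_def homogeneous_def keys_norm_component)

lemma linear_norm_component: "Vector_Spaces.linear scalar_mult scalar_mult (norm_component n)"
  unfolding Vector_Spaces.linear_iff
  by (auto intro!: poly_mapping_eqI mpoly.vector_space_axioms simp: lookup_norm_component lookup_add when_def)

text \<open>Evaluation maps monomials of norm \<open>n\<close> to elements of norm \<open>n\<close>, so taking components commutes with it.\<close>

lemma eval_norm_component:
  assumes "\<And>j. j \<in> {1..m} \<Longrightarrow> coh_homogeneous d j (x j)" "p \<in> poly_ring m"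
  shows "eval_hom d m x (norm_component n p) =
    (\<lambda>\<sigma>. if perm_norm d \<sigma> = n then eval_hom d m x p \<sigma> else 0)"
proof
  fix \<sigma>
  let ?K = "Poly_Mapping.keys p" and ?v = "monomial_value d m x"
  have v: "?v a \<sigma> = 0" if "a \<in> ?K" "perm_norm d \<sigma> \<noteq> mono_norm a" for a
  proof -
    have "Poly_Mapping.keys a \<subseteq> {1..m}" using that assms(2) by (auto simp: poly_ring_def)
    then show ?thesis
      using monomial_value_norm[OF assms(1), of m] that by (auto simp: coh_homogeneous_def)
  qed
  have "eval_hom d m x (norm_component n p) \<sigma> =
    (\<Sum>a\<in>?K. Poly_Mapping.lookup (norm_component n p) a * ?v a \<sigma>)"
    using assms(1) by (subst eval_hom_sum[where K = ?K]) (auto simp: keys_norm_component)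
  also have "\<dots> = (\<Sum>a\<in>?K. if perm_norm d \<sigma> = n then Poly_Mapping.lookup p a * ?v a \<sigma> else 0)"
    using v by (intro sum.cong refl) (auto simp: lookup_norm_component when_def)
  also have "\<dots> = (if perm_norm d \<sigma> = n then eval_hom d m x p \<sigma> else 0)"
    using assms(1) by (subst eval_hom_sum[where K = ?K]) auto
  finally show "eval_hom d m x (norm_component n p) \<sigma> =
    (if perm_norm d \<sigma> = n then eval_hom d m x p \<sigma> else 0)" .
qed

lemma relation_ideal_norm_component:
  assumes "\<And>j. j \<in> {1..m} \<Longrightarrow> coh_homogeneous d j (x j)" "p \<in> relation_ideal d m x"
  shows "norm_component n p \<in> graded_part n (relation_ideal d m x)"
  using assms(2) norm_component_in_graded_part[of p m n] eval_norm_component[OF assms(1), of m p n]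
  by (auto simp: relation_ideal_def graded_part_def hilb_coh_simps)

text \<open>Surjectivity holds in each norm separately: of a preimage of a homogeneous element only the
  component of its norm matters.\<close>

lemma eval_graded_part:
  assumes "homogeneous_generators d m x"
  shows "eval_hom d m x ` graded_part n (poly_ring m) = {f. coh_homogeneous d n f}"
proof (intro equalityI subsetI)
  have x: "coh_homogeneous d j (x j)" if "j \<in> {1..m}" for j
    using assms that by (simp add: homogeneous_generators_def)
  have im: "eval_hom d m x ` poly_ring m = carrier (hilb_coh d)"
    using assms by (simp add: homogeneous_generators_def)
  {
    fix f assume "f \<in> eval_hom d m x ` graded_part n (poly_ring m)"
    then obtain p where p: "p \<in> poly_ring m" "homogeneous n p" "f = eval_hom d m x p"
      by (auto simp: graded_part_def)
    have "f \<in> carrier (hilb_coh d)" using p im by blast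
    moreover have "norm_component n p = p" by (simp add: norm_component_homogeneous[OF p(2)])
    then have "f \<sigma> = (if perm_norm d \<sigma> = n then f \<sigma> else 0)" for \<sigma>
      using fun_cong[OF eval_norm_component[OF x p(1), of n], of \<sigma>] by (simp only: p(3))
    then have "perm_norm d \<sigma> = n" if "f \<sigma> \<noteq> 0" for \<sigma> using that by metis
    ultimately show "f \<in> {f. coh_homogeneous d n f}" by (simp add: coh_homogeneous_def)
  next
    fix f assume "f \<in> {f. coh_homogeneous d n f}"
    then have f: "f \<in> carrier (hilb_coh d)" "\<And>\<sigma>. f \<sigma> \<noteq> 0 \<Longrightarrow> perm_norm d \<sigma> = n"
      by (auto simp: coh_homogeneous_def)
    then obtain p where p: "p \<in> poly_ring m" "f = eval_hom d m x p" using im by blast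
    have "eval_hom d m x (norm_component n p) = f"
      using eval_norm_component[OF x p(1), of n] f(2) p by (auto simp: fun_eq_iff)
    then show "f \<in> eval_hom d m x ` graded_part n (poly_ring m)"
      using norm_component_in_graded_part[OF p(1), of n] by blast
  }
qed

section \<open>Hilbert functions of both sides\<close>

text \<open>The condition on the size says that a permutation with this cycle type has norm \<open>n\<close>.\<close>

definition cycle_types :: "nat \<Rightarrow> nat \<Rightarrow> nat multiset set" where
  "cycle_types d n = {M. 0 \<notin># M \<and> sum_mset M = d \<and> size M + n = d}"

text \<open>Lowering every cycle length by one turns the partitions of \<open>d\<close> into \<open>d - n\<close> positive parts into
  the weak partitions of \<open>n\<close> into \<open>d - n\<close> parts.\<close>

lemma cycle_types_image:
  assumes "n \<le> d"
  shows "cycle_types d n = image_mset Suc ` weak_partitions n (d - n)"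
proof (intro equalityI subsetI)
  fix M assume M: "M \<in> cycle_types d n"
  then obtain M' where M': "M = image_mset Suc M'"
    using image_mset_Suc_pred[of M] by (auto simp: cycle_types_def)
  then have "M' \<in> weak_partitions n (d - n)"
    using M assms by (auto simp: cycle_types_def weak_partitions_def sum_mset_image_Suc)
  then show "M \<in> image_mset Suc ` weak_partitions n (d - n)" using M' by blast
next
  fix M assume "M \<in> image_mset Suc ` weak_partitions n (d - n)"
  then show "M \<in> cycle_types d n"
    using assms by (auto simp: cycle_types_def weak_partitions_def sum_mset_image_Suc)
qed

lemma card_cycle_types:
  assumes "n \<le> d"
  shows "finite (cycle_types d n)" "card (cycle_types d n) = partition_count n (d - n)"
proof -
  have "inj (image_mset Suc)" by (simp add: multiset.inj_map)
  then have "inj_on (image_mset Suc) (weak_partitions n (d - n))" using inj_on_subset by blast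
  then show "finite (cycle_types d n)" "card (cycle_types d n) = partition_count n (d - n)"
    using weak_partitions_count[of n "d - n"] by (simp_all add: cycle_types_image[OF assms] card_image)
qed

lemma cycle_type_in_cycle_types:
  assumes "\<sigma> \<in> perms d"
  shows "cycle_type \<sigma> {1..d} \<in> cycle_types d (perm_norm d \<sigma>)"
proof -
  have p: "\<sigma> permutes {1..d}" using assms by (simp add: sym_group_carrier)
  show ?thesis
    using cycle_type_pos[OF p] sum_cycle_type[OF p] perm_norm_eq(1)[OF p]
    by (simp add: cycle_types_def size_cycle_type)
qed

definition class_indicator :: "nat \<Rightarrow> nat multiset \<Rightarrow> perm_vec" where
  "class_indicator d M = (\<lambda>\<sigma>. if \<sigma> \<in> perms d \<and> cycle_type \<sigma> {1..d} = M then 1 else 0)"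

lemma sum_fun_apply: "(\<Sum>i\<in>I. f i) x = (\<Sum>i\<in>I. f i x :: 'a :: comm_monoid_add)"
  by (induction I rule: infinite_finite_induct) auto

lemma class_function:
  assumes "f \<in> carrier (hilb_coh d)" "\<sigma> \<in> perms d" "\<tau> \<in> perms d"
    "cycle_type \<sigma> {1..d} = cycle_type \<tau> {1..d}"
  shows "f \<sigma> = f \<tau>"
proof -
  obtain h where h: "h permutes {1..d}" "h \<circ> \<sigma> = \<tau> \<circ> h"
    using conjugate_if_same_cycle_type[of \<sigma> "{1..d}" \<tau>] assms by (auto simp: sym_group_carrier)
  have hp: "h \<in> perms d" using h by (simp add: sym_group_carrier)
  have "conj_by h \<sigma> = \<tau>"
    using h(2) perms_inv_o[OF hp] by (simp add: conj_by_def comp_assoc)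
  then show ?thesis using assms hp by (auto simp: hilb_coh_carrier)
qed

text \<open>The indicator functions of the conjugacy classes of norm \<open>n\<close> form a basis; the coordinate of a
  class function is its value at a representative.\<close>

lemma dim_coh_homogeneous:
  assumes "n \<le> d"
  shows "pvec.dim {f. coh_homogeneous d n f} = partition_count n (d - n)"
proof -
  have "\<exists>\<sigma>\<in>perms d. cycle_type \<sigma> {1..d} = M" if "M \<in> cycle_types d n" for M
    using exists_permutation_of_cycle_type[of "{1..d}" M] that
    by (auto simp: cycle_types_def sym_group_carrier)
  then obtain rep where rep: "rep M \<in> perms d" "cycle_type (rep M) {1..d} = M"
    if "M \<in> cycle_types d n" for M by metis
  let ?v = "class_indicator d"
  have sum: "(\<Sum>M\<in>cycle_types d n. vec_scale (c M) (?v M)) \<sigma> =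
    (if \<sigma> \<in> perms d \<and> cycle_type \<sigma> {1..d} \<in> cycle_types d n then c (cycle_type \<sigma> {1..d}) else 0)"
    for c \<sigma>
  proof -
    have "(\<Sum>M\<in>cycle_types d n. vec_scale (c M) (?v M)) \<sigma> =
      (\<Sum>M\<in>cycle_types d n. if cycle_type \<sigma> {1..d} = M then if \<sigma> \<in> perms d then c M else 0 else 0)"
      unfolding sum_fun_apply by (intro sum.cong) (auto simp: vec_scale_def class_indicator_def)
    then show ?thesis using card_cycle_types(1)[OF assms] by simp
  qed
  have "pvec.dim {f. coh_homogeneous d n f} = card (cycle_types d n)"
  proof (rule pvec.dim_eq_card_coordinates(1)[where v = ?v and \<phi> = "\<lambda>f M. f (rep M)"])
    show "finite (cycle_types d n)" by (rule card_cycle_types(1)[OF assms])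
    show "?v ` cycle_types d n \<subseteq> {f. coh_homogeneous d n f}"
    proof clarify
      fix M assume M: "M \<in> cycle_types d n"
      have "cycle_type (conj_by \<sigma> \<tau>) {1..d} = cycle_type \<tau> {1..d}" if "\<sigma> \<in> perms d" "\<tau> \<in> perms d" for \<sigma> \<tau>
        using that unfolding conj_by_def sym_group_carrier by (rule cycle_type_conj)
      moreover have "perm_norm d \<sigma> = n" if "\<sigma> \<in> perms d" "cycle_type \<sigma> {1..d} = M" for \<sigma>
        using cycle_type_in_cycle_types[OF that(1)] that(2) M by (simp add: cycle_types_def)
      ultimately show "coh_homogeneous d n (?v M)"
        by (auto simp: coh_homogeneous_def hilb_coh_carrier class_indicator_def conj_by_perms split: if_splits)
    qed
    show "f = (\<Sum>M\<in>cycle_types d n. vec_scale (f (rep M)) (?v M))" if "f \<in> {f. coh_homogeneous d n f}" for f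
    proof
      fix \<sigma>
      have f: "f \<in> carrier (hilb_coh d)" "\<And>\<sigma>. f \<sigma> \<noteq> 0 \<Longrightarrow> perm_norm d \<sigma> = n"
        using that by (auto simp: coh_homogeneous_def)
      show "f \<sigma> = (\<Sum>M\<in>cycle_types d n. vec_scale (f (rep M)) (?v M)) \<sigma>"
      proof (cases "\<sigma> \<in> perms d \<and> cycle_type \<sigma> {1..d} \<in> cycle_types d n")
        case True
        then have "f \<sigma> = f (rep (cycle_type \<sigma> {1..d}))"
          using rep by (intro class_function[OF f(1)]) auto
        then show ?thesis using True by (simp add: sum)
      next
        case False
        then have "f \<sigma> = 0"
          using f cycle_type_in_cycle_types[of \<sigma> d] by (auto simp: hilb_coh_carrier)
        then show ?thesis using False by (auto simp: sum)
      qed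
    qed
    show "c M = 0" if "(\<Sum>M\<in>cycle_types d n. vec_scale (c M) (?v M)) = 0" "M \<in> cycle_types d n" for c M
      using sum[of c "rep M"] that rep[OF that(2)] by simp
  qed
  then show ?thesis using card_cycle_types(2)[OF assms] by simp
qed

lemma poly_graded_part:
  "p \<in> graded_part n (poly_ring m) \<longleftrightarrow> Poly_Mapping.keys p \<subseteq> monomials n m"
  by (auto simp: graded_part_def poly_ring_def homogeneous_def monomials_def)

lemma dim_poly_graded_part:
  shows "mpoly.dim (graded_part n (poly_ring m)) = partition_count n m"
    and "graded_part n (poly_ring m) \<subseteq> mpoly.span ((\<lambda>a. Poly_Mapping.single a 1) ` monomials n m)"
proof -
  let ?v = "\<lambda>a :: monomial. Poly_Mapping.single a (1 :: rat)"
  have fin: "finite (monomials n m)" using monomials_count by blast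
  have sum: "Poly_Mapping.lookup (\<Sum>a\<in>monomials n m. scalar_mult (c a) (?v a)) b =
    (if b \<in> monomials n m then c b else 0)" for c b
  proof -
    have "Poly_Mapping.lookup (\<Sum>a\<in>monomials n m. scalar_mult (c a) (?v a)) b =
      (\<Sum>a\<in>monomials n m. if b = a then c a else 0)"
      unfolding Poly_Mapping.lookup_sum by (intro sum.cong) (auto simp: lookup_single)
    then show ?thesis using fin by simp
  qed
  have sub: "?v ` monomials n m \<subseteq> graded_part n (poly_ring m)"
    by (auto simp: poly_graded_part)
  have expand: "p = (\<Sum>a\<in>monomials n m. scalar_mult (Poly_Mapping.lookup p a) (?v a))"
    if "p \<in> graded_part n (poly_ring m)" for p
    using that by (intro poly_mapping_eqI) (auto simp: sum poly_graded_part in_keys_iff)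
  have indep: "c a = 0"
    if "(\<Sum>a\<in>monomials n m. scalar_mult (c a) (?v a)) = 0" "a \<in> monomials n m" for c a
    using sum[of c a] that by simp
  note basis = mpoly.dim_eq_card_coordinates
    [where v = ?v and \<phi> = Poly_Mapping.lookup and I = "monomials n m" and V = "graded_part n (poly_ring m)",
      OF fin sub]
  have "mpoly.dim (graded_part n (poly_ring m)) = card (monomials n m)"
    by (rule basis(1)) (fact expand, fact indep)
  then show "mpoly.dim (graded_part n (poly_ring m)) = partition_count n m"
    using monomials_count[of n m] by simp
  show "graded_part n (poly_ring m) \<subseteq> mpoly.span (?v ` monomials n m)"
    by (rule basis(2)) (fact expand, fact indep)
qed

lemma relation_graded_part:
  "graded_part n (relation_ideal d m x) = {p \<in> graded_part n (poly_ring m). eval_hom d m x p = 0}"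
  by (auto simp: graded_part_def relation_ideal_def hilb_coh_simps zero_fun_def)

text \<open>Rank-nullity for the evaluation in norm \<open>n\<close>.\<close>

lemma dim_relations:
  assumes "homogeneous_generators d m x" "n \<le> d"
  shows "mpoly.dim (graded_part n (relation_ideal d m x)) + partition_count n (d - n) = partition_count n m"
proof -
  have x: "coh_homogeneous d j (x j)" if "j \<in> {1..m}" for j
    using assms that by (simp add: homogeneous_generators_def)
  have lin: "Vector_Spaces.linear scalar_mult vec_scale (eval_hom d m x)"
    using x by (rule linear_eval_hom)
  have fin: "finite ((\<lambda>a. Poly_Mapping.single a (1 :: rat)) ` monomials n m)"
    using monomials_count by blast
  have "mpoly.subspace (graded_part n (poly_ring m))"
    by (auto simp: mpoly.subspace_def poly_graded_part in_keys_iff lookup_add subset_iff)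
      (metis add.right_neutral)
  from dim_kernel_add_dim_image[OF lin this dim_poly_graded_part(2) fin]
  show ?thesis
    by (simp add: relation_graded_part eval_graded_part[OF assms(1)] dim_coh_homogeneous[OF assms(2)]
        dim_poly_graded_part(1))
qed

lemma relation_basis:
  obtains B where "finite B" "card B = mpoly.dim (graded_part n (relation_ideal d m x))"
    "B \<subseteq> graded_part n (relation_ideal d m x)" "mpoly.independent B"
    "graded_part n (relation_ideal d m x) \<subseteq> mpoly.span B"
proof -
  obtain B where B: "B \<subseteq> graded_part n (relation_ideal d m x)" "mpoly.independent B"
    "graded_part n (relation_ideal d m x) \<subseteq> mpoly.span B"
    "card B = mpoly.dim (graded_part n (relation_ideal d m x))"
    using mpoly.basis_exists by blast
  have fin: "finite ((\<lambda>a. Poly_Mapping.single a (1 :: rat)) ` monomials n m)"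
    using monomials_count by blast
  have "B \<subseteq> mpoly.span ((\<lambda>a. Poly_Mapping.single a 1) ` monomials n m)"
    using B(1) dim_poly_graded_part(2)[of n m] by (auto simp: relation_graded_part)
  then have "finite B" using mpoly.independent_span_bound[OF fin B(2)] by blast
  then show ?thesis using that B by blast
qed

section \<open>Indecomposable relations in the lowest norm\<close>

text \<open>In a product, the first factor raises the norm by at least one, and the second has no components of
  norm below \<open>n\<close>.\<close>

lemma decomposable_norm_component:
  assumes x: "\<And>j. j \<in> {1..m} \<Longrightarrow> coh_homogeneous d j (x j)"
    and triv: "\<And>k. k < n \<Longrightarrow> graded_part k (relation_ideal d m x) \<subseteq> {0}"
    and q: "q \<in> decomposable_relations d m x" and "k \<le> n"
  shows "norm_component k q = 0"
proof -
  interpret Vector_Spaces.linear scalar_mult scalar_mult "norm_component k"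
    by (rule linear_norm_component)
  have prod: "norm_component k (f * g) = 0"
    if f: "f \<in> augmentation_ideal m" and g: "g \<in> relation_ideal d m x" for f g
  proof (rule ccontr)
    assume "norm_component k (f * g) \<noteq> 0"
    then obtain a where "a \<in> Poly_Mapping.keys (norm_component k (f * g))" by fastforce
    then have a: "a \<in> Poly_Mapping.keys (f * g)" "mono_norm a = k" by (auto simp: keys_norm_component)
    then obtain b c where bc: "a = b + c" "b \<in> Poly_Mapping.keys f" "c \<in> Poly_Mapping.keys g"
      using Poly_Mapping.keys_mult[of f g] by blast
    have "mono_norm b > 0" using f bc by (auto simp: augmentation_ideal_def)
    then have "mono_norm c < n" using a bc \<open>k \<le> n\<close> by (simp add: mono_norm_plus)
    then have "norm_component (mono_norm c) g = 0"
      using triv relation_ideal_norm_component[OF x g] by blast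
    moreover have "c \<in> Poly_Mapping.keys (norm_component (mono_norm c) g)"
      using bc by (simp add: keys_norm_component)
    ultimately show False by simp
  qed
  obtain l :: nat and f g where "q = (\<Sum>i<l. f i * g i)"
    "\<forall>i<l. f i \<in> augmentation_ideal m \<and> g i \<in> relation_ideal d m x"
    using q by (auto simp: decomposable_relations_def prod_ideal_def)
  then show ?thesis using prod by (simp add: sum)
qed

lemma zero_decomposable: "0 \<in> decomposable_relations d m x"
  unfolding decomposable_relations_def prod_ideal_def
  by (intro CollectI exI[of _ 0]) simp

text \<open>As relations start in norm \<open>n\<close> at the earliest, no non-zero decomposable relation has norm \<open>n\<close>.
  There is nothing to divide out, so a basis of the relations of norm \<open>n\<close> serves.\<close>

lemma indecomposables_dim_eq:
  assumes "\<And>j. j \<in> {1..m} \<Longrightarrow> coh_homogeneous d j (x j)"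
    and "\<And>k. k < n \<Longrightarrow> graded_part k (relation_ideal d m x) \<subseteq> {0}"
  shows "indecomposables_dim d m x n (mpoly.dim (graded_part n (relation_ideal d m x)))"
proof -
  let ?W = "graded_part n (decomposable_relations d m x)"
  have W: "q = 0" if "q \<in> ?W" for q
  proof -
    have q: "q \<in> decomposable_relations d m x" "homogeneous n q"
      using that by (simp_all add: graded_part_def)
    have "norm_component n q = 0"
      using assms q(1) order_refl by (rule decomposable_norm_component)
    then show ?thesis using norm_component_homogeneous[OF q(2), of n] by simp
  qed
  have W0: "0 \<in> ?W" by (simp add: graded_part_def zero_decomposable homogeneous_def)
  obtain B where B: "finite B" "card B = mpoly.dim (graded_part n (relation_ideal d m x))"
    "B \<subseteq> graded_part n (relation_ideal d m x)" "mpoly.independent B"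
    "graded_part n (relation_ideal d m x) \<subseteq> mpoly.span B"
    by (rule relation_basis)
  have "\<exists>F c. finite F \<and> F \<subseteq> B \<and> v - (\<Sum>b\<in>F. scalar_mult (c b) b) \<in> ?W"
    if "v \<in> graded_part n (relation_ideal d m x)" for v
  proof -
    have "v \<in> mpoly.span B" using that B(5) by blast
    then obtain c where "v = (\<Sum>b\<in>B. scalar_mult (c b) b)"
      unfolding mpoly.span_finite[OF B(1)] by blast
    then show ?thesis using B(1) W0 by (intro exI[of _ B] exI[of _ c]) simp
  qed
  moreover have "c b = 0"
    if "finite F" "F \<subseteq> B" "(\<Sum>b\<in>F. scalar_mult (c b) b) \<in> ?W" "b \<in> F" for F c b
    using mpoly.independentD[OF B(4) that(1,2) W[OF that(3)] that(4)] .
  ultimately have "projects_to_basis B (graded_part n (relation_ideal d m x)) ?W"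
    unfolding projects_to_basis_def using B(3) by blast
  then show ?thesis
    unfolding indecomposables_dim_def has_quotient_dim_def using B(1,2) by blast
qed

text \<open>Taking components of norm \<open>n\<close> kills all decomposable relations and all minimal relations of other
  norms, so the minimal relations of norm \<open>n\<close> span, hence form a basis of, the relations of norm \<open>n\<close>.\<close>

lemma card_minimal_relations:
  assumes "\<And>j. j \<in> {1..m} \<Longrightarrow> coh_homogeneous d j (x j)"
    and "\<And>k. k < n \<Longrightarrow> graded_part k (relation_ideal d m x) \<subseteq> {0}"
    and R: "minimal_relations d m x R"
  shows "card {r \<in> R. homogeneous n r} = mpoly.dim (graded_part n (relation_ideal d m x))"
proof -
  let ?R = "{r \<in> R. homogeneous n r}"
  interpret Vector_Spaces.linear scalar_mult scalar_mult "norm_component n"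
    by (rule linear_norm_component)
  have hom: "\<exists>k. homogeneous k r" if "r \<in> R" for r
    using R that by (simp add: minimal_relations_def)
  have sub: "R \<subseteq> relation_ideal d m x"
    and gen: "\<And>v. v \<in> relation_ideal d m x \<Longrightarrow>
      \<exists>F c. finite F \<and> F \<subseteq> R \<and> v - (\<Sum>b\<in>F. scalar_mult (c b) b) \<in> decomposable_relations d m x"
    and ind: "\<And>F c b. finite F \<Longrightarrow> F \<subseteq> R \<Longrightarrow>
      (\<Sum>b\<in>F. scalar_mult (c b) b) \<in> decomposable_relations d m x \<Longrightarrow> b \<in> F \<Longrightarrow> c b = 0"
    using R by (auto simp: minimal_relations_def projects_to_basis_def)
  have "mpoly.independent ?R"
    unfolding mpoly.independent_explicit_finite_subsets
    using ind zero_decomposable[of d m x] by (metis (no_types, lifting) mem_Collect_eq subset_iff)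
  moreover have "?R \<subseteq> graded_part n (relation_ideal d m x)"
    using sub by (auto simp: graded_part_def)
  moreover have "graded_part n (relation_ideal d m x) \<subseteq> mpoly.span ?R"
  proof
    fix v assume "v \<in> graded_part n (relation_ideal d m x)"
    then have v: "v \<in> relation_ideal d m x" "norm_component n v = v"
      by (auto simp: graded_part_def norm_component_homogeneous[of n v n])
    obtain F c where F: "finite F" "F \<subseteq> R"
      "v - (\<Sum>b\<in>F. scalar_mult (c b) b) \<in> decomposable_relations d m x"
      using gen[OF v(1)] by blast
    have "norm_component n (v - (\<Sum>b\<in>F. scalar_mult (c b) b)) = 0"
      using assms(1,2) F(3) order_refl by (rule decomposable_norm_component)
    then have "v = (\<Sum>b\<in>F. scalar_mult (c b) (norm_component n b))"
      by (simp add: diff sum scale v(2))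
    also have "\<dots> \<in> mpoly.span ?R"
    proof (intro mpoly.span_sum mpoly.span_scale)
      fix b assume "b \<in> F"
      then have b: "b \<in> R" using F(2) by blast
      then obtain k where k: "homogeneous k b" using hom by blast
      show "norm_component n b \<in> mpoly.span ?R"
        using b k by (auto simp: norm_component_homogeneous[OF k] mpoly.span_zero intro: mpoly.span_base)
    qed
    finally show "v \<in> mpoly.span ?R" .
  qed
  ultimately show ?thesis using mpoly.basis_card_eq_dim by blast
qed

theorem theorem1p2:
  fixes d m :: nat and x :: "nat \<Rightarrow> perm_vec"
  assumes "d \<ge> 1" and "m = d div 2"
    and "homogeneous_generators d m x"
  shows "(\<forall>n\<le>d - m. \<forall>p\<in>relation_ideal d m x. homogeneous n p \<longrightarrow> p = 0)
    \<and> (d \<ge> 2 \<and> d = 2 * m \<longrightarrow>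
        (\<forall>R. minimal_relations d m x R \<longrightarrow> card {r \<in> R. homogeneous (m + 1) r} = 1))
    \<and> (d \<ge> 5 \<and> d = 2 * m + 1 \<longrightarrow>
        (\<forall>R. minimal_relations d m x R \<longrightarrow> card {r \<in> R. homogeneous (m + 2) r} = 2))
    \<and> (\<forall>n < d - m + 1. indecomposables_dim d m x n 0)
    \<and> (d \<ge> 2 \<and> even d \<longrightarrow> indecomposables_dim d m x (d - m + 1) 1)
    \<and> (d \<ge> 5 \<and> odd d \<longrightarrow> indecomposables_dim d m x (d - m + 1) 2)"
proof -
  let ?I = "\<lambda>n. graded_part n (relation_ideal d m x)"
  have x: "coh_homogeneous d j (x j)" if "j \<in> {1..m}" for j
    using assms(3) that by (simp add: homogeneous_generators_def)
  have dim: "mpoly.dim (?I n) + partition_count n (d - n) = partition_count n m" if "n \<le> d" for n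
    using dim_relations[OF assms(3) that] .
  have dim0: "mpoly.dim (?I n) = 0" if "n \<le> d - m" for n
  proof -
    have "partition_count n m \<le> partition_count n (d - n)"
      using that assms(2) by (intro partition_count_mono) linarith
    moreover have "n \<le> d" using that by simp
    ultimately show ?thesis using dim[of n] by linarith
  qed
  have triv: "?I n \<subseteq> {0}" if "n < d - m + 1" for n
  proof -
    obtain B where "finite B" "card B = mpoly.dim (?I n)" "?I n \<subseteq> mpoly.span B"
      by (rule relation_basis)
    then show ?thesis using dim0[of n] that by simp
  qed
  \<comment> \<open>The recursion for \<open>p(n, m)\<close> is read as \<open>p(n, m) - p(n, m - 1) = p(n - m, m)\<close>, where \<open>m - 1 = d - n\<close>.\<close>
  have dim1: "mpoly.dim (?I (m + 1)) = 1" if "d \<ge> 2" "d = 2 * m"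
  proof -
    have "d - (m + 1) = m - 1" using that by simp
    moreover have "partition_count (m + 1) m = partition_count (m + 1) (m - 1) + partition_count 1 m"
      using that partition_count.simps(2)[of "m + 1" "m - 1"] by simp
    ultimately show ?thesis using dim[of "m + 1"] that partition_count_1[of m] by simp
  qed
  have dim2: "mpoly.dim (?I (m + 2)) = 2" if "d \<ge> 5" "d = 2 * m + 1"
  proof -
    have "d - (m + 2) = m - 1" using that by simp
    moreover have "partition_count (m + 2) m = partition_count (m + 2) (m - 1) + partition_count 2 m"
      using that partition_count.simps(2)[of "m + 2" "m - 1"] by simp
    ultimately show ?thesis using dim[of "m + 2"] that partition_count_2[of m] by simp
  qed
  show ?thesis
  proof (intro conjI allI impI ballI)
    fix n p assume "n \<le> d - m" "p \<in> relation_ideal d m x" "homogeneous n p"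
    then show "p = 0" using triv[of n] by (auto simp: graded_part_def)
  next
    fix R assume d: "d \<ge> 2 \<and> d = 2 * m" and R: "minimal_relations d m x R"
    have "card {r \<in> R. homogeneous (m + 1) r} = mpoly.dim (?I (m + 1))"
    proof (rule card_minimal_relations[OF x _ R])
      show "?I k \<subseteq> {0}" if "k < m + 1" for k by (rule triv) (use that d in simp)
    qed
    then show "card {r \<in> R. homogeneous (m + 1) r} = 1" using dim1 d by simp
  next
    fix R assume d: "d \<ge> 5 \<and> d = 2 * m + 1" and R: "minimal_relations d m x R"
    have "card {r \<in> R. homogeneous (m + 2) r} = mpoly.dim (?I (m + 2))"
    proof (rule card_minimal_relations[OF x _ R])
      show "?I k \<subseteq> {0}" if "k < m + 2" for k by (rule triv) (use that d in simp)
    qed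
    then show "card {r \<in> R. homogeneous (m + 2) r} = 2" using dim2 d by simp
  next
    fix n assume n: "n < d - m + 1"
    have "indecomposables_dim d m x n (mpoly.dim (?I n))"
      by (rule indecomposables_dim_eq[OF x triv]) (use n in auto)
    then show "indecomposables_dim d m x n 0" using dim0[of n] n by simp
  next
    assume d: "d \<ge> 2 \<and> even d"
    then have "d = 2 * m" "d - m + 1 = m + 1" using assms(2) by auto
    moreover have "indecomposables_dim d m x (d - m + 1) (mpoly.dim (?I (d - m + 1)))"
      by (rule indecomposables_dim_eq[OF x triv])
    ultimately show "indecomposables_dim d m x (d - m + 1) 1" using dim1 d by simp
  next
    assume d: "d \<ge> 5 \<and> odd d"
    then have "d = 2 * m + 1" "d - m + 1 = m + 2" using assms(2) by (auto elim!: oddE)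
    moreover have "indecomposables_dim d m x (d - m + 1) (mpoly.dim (?I (d - m + 1)))"
      by (rule indecomposables_dim_eq[OF x triv])
    ultimately show "indecomposables_dim d m x (d - m + 1) 2" using dim2 d by simp
  qed
qed

end
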